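(* Let $\Sigma\in\mathcal{G}_n$ and let $Q_0$ be the unique regular rational orthogonal matrix with $Q_0^{\rm T}S(\Sigma)Q_0=S(\Sigma^{\rm T})$, with level $\ell_0$. Suppose that $\ell_0=p_1p_2\cdots p_t$, where the $p_i$ are distinct odd primes, for some $t\ge 0$. Then, up to isomorphism, the number of generalized cospectral mates of $\Sigma$ is at most $2^t-1$.
   Context: An oriented graph $\Sigma$ on vertices $v_1,\dots,v_n$ is a simple graph each of whose edges is given a direction. Its skew-adjacency matrix $S(\Sigma)=(s_{ij})$ has $s_{ij}=1$ if $(v_i,v_j)$ is an arc, $s_{ij}=-1$ if $(v_j,v_i)$ is an arc, and $s_{ij}=0$ otherwise. The converse $\Sigma^{\rm T}$ is obtained by reversing every arc, so $S(\Sigma^{\rm T})=-S(\Sigma)$. Two oriented graphs $\Sigma,\Delta$ are isomorphic if $S(\Delta)=P^{\rm T}S(\Sigma)P$ for some permutation matrix $P$. They are generalized cospectral if $S(\Sigma)$ and $S(\Delta)$ have the same spectrum and $J-I-S(\Sigma)$ and $J-I-S(\Delta)$ have the same spectrum ($J$ the all-one matrix, $I$ the identity). A generalized cospectral mate of $\Sigma$ is an oriented graph that is generalized cospectral with $\Sigma$ but not isomorphic to $\Sigma$. Let $e$ be the all-one vector and $W(\Sigma)=[e,Se,\dots,S^{n-1}e]$ with $S=S(\Sigma)$ (the skew-walk matrix). $\mathcal{G}_n$ is the set of all $n$-vertex oriented graphs $\Sigma$ such that $2^{-\lfloor n/2\rfloor}\det W(\Sigma)$ is an odd square-free integer. A rational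 orthogonal matrix $Q$ is regular if $Qe=e$; its level is the smallest positive integer $k$ such that $kQ$ is integral. For $\Sigma$ with $\det W(\Sigma)\neq0$ and any $\Delta$ generalized cospectral with $\Sigma$ there is a unique regular rational orthogonal $Q$ with $Q^{\rm T}S(\Sigma)Q=S(\Delta)$; in particular $Q_0$ above is well defined. *)

theory Defs
  imports "Jordan_Normal_Form.Char_Poly" "Jordan_Normal_Form.Determinant"
    "HOL-Computational_Algebra.Squarefree" "HOL-Combinatorics.Permutations"
begin

(* An oriented graph on vertices 0..n-1, represented by its skew-adjacency matrix. *)
definition oriented_graph :: "nat \<Rightarrow> int mat \<Rightarrow> bool" where
  "oriented_graph n S \<longleftrightarrow> S \<in> carrier_mat n n \<and>
     (\<forall>i<n. \<forall>j<n. S $$ (i,j) \<in> {-1,0,1} \<and> S $$ (j,i) = - S $$ (i,j))"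

definition all_one_vec :: "nat \<Rightarrow> 'a::one vec" where
  "all_one_vec n = vec n (\<lambda>_. 1)"

definition all_one_mat :: "nat \<Rightarrow> 'a::one mat" where
  "all_one_mat n = mat n n (\<lambda>_. 1)"

definition cospectral :: "'a::comm_ring_1 mat \<Rightarrow> 'a mat \<Rightarrow> bool" where
  "cospectral A B \<longleftrightarrow> char_poly A = char_poly B"

definition gen_cospectral :: "nat \<Rightarrow> int mat \<Rightarrow> int mat \<Rightarrow> bool" where
  "gen_cospectral n S T \<longleftrightarrow> cospectral S T \<and>
     cospectral (all_one_mat n - 1\<^sub>m n - S) (all_one_mat n - 1\<^sub>m n - T)"

definition perm_mat :: "nat \<Rightarrow> (nat \<Rightarrow> nat) \<Rightarrow> int mat" where
  "perm_mat n \<sigma> = mat n n (\<lambda>(i,j). if \<sigma> i = j then 1 else 0)"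

definition og_iso :: "nat \<Rightarrow> int mat \<Rightarrow> int mat \<Rightarrow> bool" where
  "og_iso n S T \<longleftrightarrow> (\<exists>\<sigma>. \<sigma> permutes {..<n} \<and>
      T = transpose_mat (perm_mat n \<sigma>) * S * perm_mat n \<sigma>)"

definition walk_mat :: "nat \<Rightarrow> int mat \<Rightarrow> int mat" where
  "walk_mat n S = mat n n (\<lambda>(i,j). ((S ^\<^sub>m j) *\<^sub>v all_one_vec n) $ i)"

definition in_G :: "nat \<Rightarrow> int mat \<Rightarrow> bool" where
  "in_G n S \<longleftrightarrow> oriented_graph n S \<and>
     (2::int) ^ (n div 2) dvd det (walk_mat n S) \<and>
     odd (det (walk_mat n S) div 2 ^ (n div 2)) \<and>
     squarefree (det (walk_mat n S) div 2 ^ (n div 2))"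

definition regular_rat_orth :: "nat \<Rightarrow> rat mat \<Rightarrow> bool" where
  "regular_rat_orth n Q \<longleftrightarrow> Q \<in> carrier_mat n n \<and> transpose_mat Q * Q = 1\<^sub>m n \<and>
     Q *\<^sub>v all_one_vec n = all_one_vec n"

definition level :: "rat mat \<Rightarrow> nat" where
  "level Q = (LEAST k::nat. k > 0 \<and>
     (\<forall>i<dim_row Q. \<forall>j<dim_col Q. of_nat k * Q $$ (i,j) \<in> \<int>))"

definition rat_of_int_mat :: "int mat \<Rightarrow> rat mat" where
  "rat_of_int_mat S = map_mat of_int S"

definition gc_mates :: "nat \<Rightarrow> int mat \<Rightarrow> int mat set" where
  "gc_mates n S = {T. oriented_graph n T \<and> gen_cospectral n S T \<and> \<not> og_iso n S T}"

end

theory Submission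
  imports Defs
begin

text \<open>
  Let \<open>e\<close> be the all-one vector. Every mate \<open>T\<close> has the form \<open>Q\<^sup>T S Q\<close> with \<open>Q\<close> regular rational
  orthogonal, and \<open>Q \<int>\<^sup>n\<close> is a unimodular lattice that is stable under \<open>S\<close> and contains \<open>e\<close>,
  hence contains the lattice \<open>R\<close> spanned by the vectors \<open>S\<^sup>k e\<close>. Up to isomorphism \<open>T\<close> is
  determined by \<open>Q \<int>\<^sup>n\<close>, and the lattice can be examined one prime at a time. It agrees with
  \<open>\<int>\<^sup>n\<close> at primes not dividing \<open>det W\<close>. At an odd prime \<open>p\<close> dividing \<open>det W\<close> once, \<open>R\<close> has index
  \<open>p\<close> and its discriminant group has order \<open>p\<^sup>2\<close>, so there is at most one unimodular lattice
  besides \<open>\<int>\<^sup>n\<close>. If that second lattice occurs, then \<open>S\<close> does not annihilate the kernel of \<open>W\<^sup>T\<close>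
  modulo \<open>p\<close>, whereas \<open>p\<close> not dividing the level of \<open>Q\<^sub>0\<close> would force it to do so; hence \<open>p\<close>
  divides that level. At \<open>2\<close> the index of \<open>R\<close> is minimal for parity reasons and the only
  possible lattice is \<open>\<int>\<^sup>n\<close>. So \<open>T\<close> is determined by the set of primes dividing the level of
  \<open>Q\<close>, which is a nonempty subset of the primes dividing the level of \<open>Q\<^sub>0\<close>.
\<close>

section \<open>Determinants and adjugates of polynomial matrices\<close>

text \<open>Lattices are never formalized: with l the level of Q, the integral matrix M = l Q
  replaces Q, and local statements become divisibility of scalar products of its columns. Two
  lattices agree at p when p does not divide the level of \<open>Q1\<^sup>T Q2\<close>, whose
  entries are such scalar products divided by l1 l2. The existence of Q rests on the walk counts
  e.S^k e. The spectra of S and J - I - S determine them, and by skewness they are, up to sign, the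
  entries of \<open>W\<^sup>T W\<close> and \<open>W\<^sup>T S W\<close>. The substitute is that
  p(-S) is the adjoint of p(S), while p(-x) p(x) is p(x^2) modulo 2. Pairings modulo 4 are thereby
  governed by p(x^2), and this is why a polynomial m with m(x^2) a multiple of the characteristic
  polynomial enters.\<close>

lemma all_one_mat_carrier [simp]: "all_one_mat n \<in> carrier_mat n n"
  by (simp add: all_one_mat_def)

lemma all_one_vec_carrier [simp]: "all_one_vec n \<in> carrier_vec n"
  by (simp add: all_one_vec_def)

lemma dim_all_one_vec [simp]: "dim_vec (all_one_vec n) = n"
  by (simp add: all_one_vec_def)

lemma index_all_one_vec [simp]: "i < n \<Longrightarrow> all_one_vec n $ i = 1"
  by (simp add: all_one_vec_def)

text \<open>The rank-one update of a determinant, over an integral domain where C need not have an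
  inverse. The bordered matrix \<open>M\<close> is multiplied by \<open>X\<close> on the right,
  which exposes det(C + J), and by \<open>N\<close> on the left, where adj C stands in for the
  inverse. The surplus factor det N = d^n cancels.\<close>

lemma det_add_all_one_mat:
  fixes C :: "'a :: idom mat"
  assumes C: "C \<in> carrier_mat n n" and nz: "det C \<noteq> 0"
  shows "det (C + all_one_mat n) = det C + all_one_vec n \<bullet> (adj_mat C *\<^sub>v all_one_vec n)"
proof -
  define E :: "'a mat" where "E = mat n 1 (\<lambda>_. 1)"
  define F :: "'a mat" where "F = mat 1 n (\<lambda>_. 1)"
  define I1 :: "'a mat" where "I1 = 1\<^sub>m 1"
  define d where "d = det C"
  note adj = adj_mat[OF C, folded d_def]
  have E: "E \<in> carrier_mat n 1" and F: "F \<in> carrier_mat 1 n" and I1: "I1 \<in> carrier_mat 1 1"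
    by (auto simp: E_def F_def I1_def)
  have aE: "adj_mat C * E \<in> carrier_mat n 1" and Fa: "F * adj_mat C \<in> carrier_mat 1 n"
    using adj(1) E F by auto
  define M where "M = four_block_mat C (- E) F I1"
  define X where "X = four_block_mat (1\<^sub>m n) (0\<^sub>m n 1) (- F) I1"
  define N where "N = four_block_mat (adj_mat C) (0\<^sub>m n 1) (- (F * adj_mat C)) (d \<cdot>\<^sub>m I1)"
  have Mc: "M \<in> carrier_mat (n+1) (n+1)" and Xc: "X \<in> carrier_mat (n+1) (n+1)"
    and Nc: "N \<in> carrier_mat (n+1) (n+1)"
    unfolding M_def X_def N_def using C I1 adj(1) by auto
  have J: "E * F = all_one_mat n"
    by (rule eq_matI) (auto simp: E_def F_def all_one_mat_def scalar_prod_def)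
  have P: "F * adj_mat C * E = mat 1 1 (\<lambda>_. all_one_vec n \<bullet> (adj_mat C *\<^sub>v all_one_vec n))"
  proof -
    have "F * adj_mat C * E = F * (adj_mat C * E)" using F adj(1) E by simp
    also have "\<dots> = mat 1 1 (\<lambda>_. all_one_vec n \<bullet> (adj_mat C *\<^sub>v all_one_vec n))"
      by (rule eq_matI)
        (use adj(1) in \<open>auto simp: E_def F_def all_one_vec_def scalar_prod_def intro!: sum.cong\<close>)
    finally show ?thesis .
  qed
  have "M * X = four_block_mat (C * 1\<^sub>m n + (- E) * (- F)) (C * 0\<^sub>m n 1 + (- E) * I1)
      (F * 1\<^sub>m n + I1 * (- F)) (F * 0\<^sub>m n 1 + I1 * I1)"
    unfolding M_def X_def by (rule mult_four_block_mat) (use C E F I1 in auto)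
  also have "C * 1\<^sub>m n + (- E) * (- F) = C + all_one_mat n"
    using C E F J by simp
  also have "F * 1\<^sub>m n + I1 * (- F) = 0\<^sub>m 1 n"
    by (rule eq_matI) (auto simp: I1_def F_def)
  also have "F * 0\<^sub>m n 1 + I1 * I1 = I1" using F by (simp add: I1_def)
  finally have "det (M * X) = det (C + all_one_mat n) * det I1"
    by (simp only:, intro det_four_block_mat_lower_left_zero[OF _ _ refl]; use C E I1 in simp)
  moreover have "det X = det (1\<^sub>m n) * det I1" unfolding X_def
    by (intro det_four_block_mat_upper_right_zero[OF _ refl]) (use F I1 in auto)
  ultimately have M: "det M = det (C + all_one_mat n)"
    using det_mult[OF Mc Xc] by (simp add: I1_def)
  have "N * M = four_block_mat (adj_mat C * C + 0\<^sub>m n 1 * F) (adj_mat C * (- E) + 0\<^sub>m n 1 * I1)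
      (- (F * adj_mat C) * C + (d \<cdot>\<^sub>m I1) * F) (- (F * adj_mat C) * (- E) + (d \<cdot>\<^sub>m I1) * I1)"
    unfolding M_def N_def by (rule mult_four_block_mat) (use C E F I1 adj(1) in auto)
  also have "adj_mat C * C + 0\<^sub>m n 1 * F = d \<cdot>\<^sub>m 1\<^sub>m n" using adj F by simp
  also have "- (F * adj_mat C) * C + (d \<cdot>\<^sub>m I1) * F = 0\<^sub>m 1 n"
  proof -
    have "F * adj_mat C * C = F * (adj_mat C * C)" using F adj(1) C by simp
    also have "\<dots> = d \<cdot>\<^sub>m F" unfolding adj(3) mult_smult_distrib[OF F one_carrier_mat] using F
      by simp
    finally show ?thesis using F C Fa adj(1) mult_smult_assoc_mat[OF I1 F, of d]
      by (auto simp: I1_def)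
  qed
  also have "- (F * adj_mat C) * (- E) + (d \<cdot>\<^sub>m I1) * I1
      = mat 1 1 (\<lambda>_. d + all_one_vec n \<bullet> (adj_mat C *\<^sub>v all_one_vec n))"
  proof -
    have "- (F * adj_mat C) * (- E) = F * adj_mat C * E"
      using Fa E F adj(1) by simp
    then show ?thesis unfolding P by (auto simp: I1_def)
  qed
  finally have "det (N * M) = det (d \<cdot>\<^sub>m 1\<^sub>m n)
      * det (mat 1 1 (\<lambda>_. d + all_one_vec n \<bullet> (adj_mat C *\<^sub>v all_one_vec n)))"
    by (simp only:, intro det_four_block_mat_lower_left_zero[OF _ _ refl]; use adj(1) E I1 in simp)
  then have 1: "det (N * M) = d ^ n * (d + all_one_vec n \<bullet> (adj_mat C *\<^sub>v all_one_vec n))"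
    by (simp add: det_single)
  have "det N = det (adj_mat C) * det (d \<cdot>\<^sub>m I1)"
    unfolding N_def by (intro det_four_block_mat_upper_right_zero[OF _ refl]) (use adj(1) Fa I1 in auto)
  also have "\<dots> = det (adj_mat C) * det C" by (simp add: I1_def d_def)
  also have "\<dots> = det (adj_mat C * C)" using det_mult[OF adj(1) C] ..
  also have "\<dots> = d ^ n" by (simp add: adj(3))
  finally have "det (N * M) = d ^ n * det M" using det_mult[OF Nc Mc] by simp
  with 1 nz M show ?thesis by (simp add: d_def)
qed

text \<open>A cofactor is, up to sign, a determinant of order n - 1 with entries of degree at most
  1. Applied to xI - S this bounds the remainders in the series identities.\<close>

lemma degree_adj_mat_entry:
  fixes A :: "'a :: comm_ring_1 poly mat"
  assumes A: "A \<in> carrier_mat n n"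
    and deg: "\<And>i j. i < n \<Longrightarrow> j < n \<Longrightarrow> degree (A $$ (i,j)) \<le> 1"
    and i: "i < n" and j: "j < n"
  shows "degree (adj_mat A $$ (i,j)) < n"
proof -
  have c: "mat_delete A j i \<in> carrier_mat (n-1) (n-1)" using A by (auto simp: mat_delete_def)
  have "degree (det (mat_delete A j i)) \<le> 1 * (n - 1)"
  proof (rule degree_det_le[OF _ c])
    fix k l assume "k < n - 1" "l < n - 1"
    then show "degree (mat_delete A j i $$ (k, l)) \<le> 1"
      using A deg[unfolded One_nat_def] by (auto simp: mat_delete_def)
  qed
  moreover have "degree ((-1)^(j+i) * p) = degree p" for p :: "'a poly"
    by (cases "even (j+i)") auto
  ultimately show ?thesis using A i j by (auto simp: adj_mat_def cofactor_def)
qed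

section \<open>Walk counts and generalized cospectrality\<close>

lemma smult_mat_mult_vec:
  fixes A :: "'a :: comm_semiring_0 mat"
  assumes "A \<in> carrier_mat nr nc" "x \<in> carrier_vec nc"
  shows "(c \<cdot>\<^sub>m A) *\<^sub>v x = c \<cdot>\<^sub>v (A *\<^sub>v x)"
  by (rule eq_vecI) (use assms in auto)

lemma mult_mat_smult_vec:
  fixes A :: "'a :: comm_semiring_0 mat"
  assumes "A \<in> carrier_mat nr nc" "x \<in> carrier_vec nc"
  shows "A *\<^sub>v (c \<cdot>\<^sub>v x) = c \<cdot>\<^sub>v (A *\<^sub>v x)"
  by (rule eq_vecI) (use assms in auto)

locale square_int_mat =
  fixes n :: nat and S :: "int mat"
  assumes S_carrier [simp]: "S \<in> carrier_mat n n"
begin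

lemma dim_S [simp]: "dim_row S = n" "dim_col S = n"
  by (rule carrier_matD[OF S_carrier])+

definition walk_vec :: "nat \<Rightarrow> int vec" where
  "walk_vec k = (S ^\<^sub>m k) *\<^sub>v all_one_vec n"

definition walk_count :: "nat \<Rightarrow> int" where
  "walk_count k = all_one_vec n \<bullet> walk_vec k"

lemma walk_vec_carrier [simp]: "walk_vec k \<in> carrier_vec n"
  unfolding walk_vec_def by (intro mult_mat_vec_carrier[of _ n n]) auto

lemma dim_walk_vec [simp]: "dim_vec (walk_vec k) = n"
  using walk_vec_carrier by (rule carrier_vecD)

lemma walk_vec_0 [simp]: "walk_vec 0 = all_one_vec n"
  by (simp add: walk_vec_def one_mult_mat_vec[of _ n])

lemma pow_Suc_left: "S ^\<^sub>m (Suc k) = S * S ^\<^sub>m k"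
proof (induction k)
  case 0
  then show ?case by (simp add: right_mult_one_mat[of _ n n] left_mult_one_mat[of _ n n])
next
  case (Suc k)
  have "S ^\<^sub>m (Suc (Suc k)) = S ^\<^sub>m (Suc k) * S" by simp
  also have "\<dots> = S * S ^\<^sub>m k * S" unfolding Suc ..
  also have "\<dots> = S * S ^\<^sub>m (Suc k)"
    by (simp add: assoc_mult_mat[of _ n n _ n _ n])
  finally show ?case .
qed

lemma walk_vec_Suc: "walk_vec (Suc k) = S *\<^sub>v walk_vec k"
  unfolding walk_vec_def pow_Suc_left by (simp add: assoc_mult_mat_vec[of _ n n _ n])

abbreviation lift_vec :: "int vec \<Rightarrow> int poly vec" where
  "lift_vec \<equiv> map_vec (\<lambda>a. [:a:])"

abbreviation "\<chi> \<equiv> char_poly S"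
abbreviation "C \<equiv> char_poly_matrix S"

lemma C_carrier [simp]: "C \<in> carrier_mat n n" by simp

lemma dim_C [simp]: "dim_row C = n" "dim_col C = n"
  by (rule carrier_matD[OF C_carrier])+

lemma degree_char_poly_matrix:
  assumes "i < n" "j < n"
  shows "degree (C $$ (i,j)) \<le> 1"
proof -
  have "C $$ (i,j) = (if i = j then [:0,1:] else 0) + [:- S $$ (i,j):]"
    using assms by (auto simp: char_poly_matrix_def)
  then show ?thesis by simp
qed

lemma char_poly_matrix_mult_lift_vec:
  assumes x: "x \<in> carrier_vec n"
  shows "C *\<^sub>v lift_vec x = [:0,1:] \<cdot>\<^sub>v lift_vec x - lift_vec (S *\<^sub>v x)"
proof -
  interpret coeff_lift_hom: comm_ring_hom "\<lambda>a::int. [:a:]"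
    by unfold_locales auto
  have "C *\<^sub>v lift_vec x = ([:0,1:] \<cdot>\<^sub>m 1\<^sub>m n) *\<^sub>v lift_vec x
      + map_mat (\<lambda>a. [:- a:]) S *\<^sub>v lift_vec x"
    unfolding char_poly_matrix_def carrier_matD(1)[OF S_carrier]
    by (rule add_mult_distrib_mat_vec[of _ n n]) (use x in auto)
  also have "([:0,1:] \<cdot>\<^sub>m 1\<^sub>m n) *\<^sub>v lift_vec x = [:0,1:] \<cdot>\<^sub>v lift_vec x"
    using x by (auto simp: smult_mat_mult_vec[of _ n n])
  also have "map_mat (\<lambda>a. [:- a:]) S *\<^sub>v lift_vec x = - (map_mat (\<lambda>a. [:a:]) S *\<^sub>v lift_vec x)"
  proof -
    have "map_mat (\<lambda>a. [:- a:]) S = - map_mat (\<lambda>a. [:a:]) S" by auto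
    then show ?thesis using x by simp
  qed
  also have "map_mat (\<lambda>a. [:a:]) S *\<^sub>v lift_vec x = lift_vec (S *\<^sub>v x)"
    using coeff_lift_hom.mult_mat_vec_hom[OF S_carrier x] by simp
  finally show ?thesis using x by (auto simp: minus_add_uminus_vec)
qed

text \<open>The sum of x^(m-1-k) S^k e over k < m, that is, the polynomial part of x^m times the
  resolvent (xI - S)^(-1) e. Multiplication by xI - S telescopes it to x^m e - S^m e.\<close>

fun telescope_vec :: "nat \<Rightarrow> int poly vec" where
  "telescope_vec 0 = 0\<^sub>v n"
| "telescope_vec (Suc m) = [:0,1:] \<cdot>\<^sub>v telescope_vec m + lift_vec (walk_vec m)"

lemma telescope_vec_carrier [simp]: "telescope_vec m \<in> carrier_vec n"
  by (induction m) auto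

lemma dim_telescope_vec [simp]: "dim_vec (telescope_vec m) = n"
  using telescope_vec_carrier by (rule carrier_vecD)

lemma char_poly_matrix_mult_telescope_vec:
  "C *\<^sub>v telescope_vec m = monom 1 m \<cdot>\<^sub>v lift_vec (walk_vec 0) - lift_vec (walk_vec m)"
proof (induction m)
  case 0
  have "C *\<^sub>v 0\<^sub>v n = 0\<^sub>v n" by (rule eq_vecI) auto
  then show ?case by (auto simp: all_one_vec_def intro!: eq_vecI)
next
  case (Suc m)
  have "C *\<^sub>v telescope_vec (Suc m)
      = [:0,1:] \<cdot>\<^sub>v (C *\<^sub>v telescope_vec m) + C *\<^sub>v lift_vec (walk_vec m)"
    by (simp add: mult_add_distrib_mat_vec[of _ n n] mult_mat_smult_vec[of _ n n])
  also have "\<dots> = [:0,1:] \<cdot>\<^sub>v (monom 1 m \<cdot>\<^sub>v lift_vec (walk_vec 0) - lift_vec (walk_vec m))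
      + ([:0,1:] \<cdot>\<^sub>v lift_vec (walk_vec m) - lift_vec (walk_vec (Suc m)))"
    unfolding Suc by (simp add: char_poly_matrix_mult_lift_vec walk_vec_Suc)
  also have "\<dots> = monom 1 (Suc m) \<cdot>\<^sub>v lift_vec (walk_vec 0) - lift_vec (walk_vec (Suc m))"
    by (rule eq_vecI) (auto simp: monom_Suc)
  finally show ?case .
qed

lemma char_poly_smult_telescope_vec:
  "\<chi> \<cdot>\<^sub>v telescope_vec m
    = monom 1 m \<cdot>\<^sub>v (adj_mat C *\<^sub>v lift_vec (walk_vec 0)) - adj_mat C *\<^sub>v lift_vec (walk_vec m)"
proof -
  note adj = adj_mat[OF C_carrier]
  have "\<chi> \<cdot>\<^sub>v telescope_vec m = (adj_mat C * C) *\<^sub>v telescope_vec m"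
    unfolding adj(3) char_poly_def by (simp add: smult_mat_mult_vec[of _ n n])
  also have "\<dots> = adj_mat C *\<^sub>v (C *\<^sub>v telescope_vec m)"
    using adj(1) by (intro assoc_mult_mat_vec) auto
  finally show ?thesis
    unfolding char_poly_matrix_mult_telescope_vec using adj(1)
    by (simp add: mult_minus_distrib_mat_vec[of _ n n] mult_mat_smult_vec[of _ n n])
qed

lemma index_telescope_vec:
  "r < n \<Longrightarrow> telescope_vec m $ r = (\<Sum>k<m. monom (walk_vec k $ r) (m - 1 - k))"
proof (induction m)
  case (Suc m)
  have "telescope_vec (Suc m) $ r = [:0,1:] * telescope_vec m $ r + [:walk_vec m $ r:]"
    using Suc.prems by (simp del: add_pCons mult_pCons_left)
  also have "\<dots> = (\<Sum>k<m. monom (walk_vec k $ r) (m - k)) + [:walk_vec m $ r:]"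
    unfolding Suc.IH[OF Suc.prems] sum_distrib_left
    by (intro arg_cong2[of _ _ _ _ plus] sum.cong refl)
      (simp_all add: monom_Suc[symmetric] Suc_diff_Suc)
  finally show ?case by (simp add: monom_0)
qed simp

lemma degree_adj_char_poly_matrix_mult_lift_vec:
  assumes x: "x \<in> carrier_vec n" and r: "r < n"
  shows "degree ((adj_mat C *\<^sub>v lift_vec x) $ r) < n"
proof -
  have "degree (adj_mat C $$ (r,j) * [:x $ j:]) < n" if "j < n" for j
  proof -
    have "degree (adj_mat C $$ (r,j)) < n"
      using r that by (intro degree_adj_mat_entry C_carrier degree_char_poly_matrix)
    then show ?thesis
      using degree_mult_le[of "adj_mat C $$ (r,j)" "[:x $ j:]"] by simp
  qed
  then have "degree (\<Sum>j\<in>{0..<n}. adj_mat C $$ (r,j) * [:x $ j:]) < n"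
    using r by (intro degree_sum_less) auto
  then show ?thesis using adj_mat(1)[OF C_carrier] r x by (simp add: scalar_prod_def)
qed

text \<open>Cayley-Hamilton applied to e, by comparing coefficients of x^n in the telescoping
  identity of length n + 1. On its right-hand side one term starts at x^(n+1), and the other has
  degree below n because adjugate entries do.\<close>

lemma char_poly_annihilates_all_one_vec:
  assumes r: "r < n"
  shows "(\<Sum>k\<le>n. coeff \<chi> k * walk_vec k $ r) = 0"
proof -
  let ?q = "\<lambda>k. (adj_mat C *\<^sub>v lift_vec (walk_vec k)) $ r"
  have "\<chi> * telescope_vec (Suc n) $ r = monom 1 (Suc n) * ?q 0 - ?q (Suc n)"
    using arg_cong[OF char_poly_smult_telescope_vec[of "Suc n"], of "\<lambda>v. v $ r"] r
      adj_mat(1)[OF C_carrier] by (simp del: telescope_vec.simps)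
  then have "coeff (\<chi> * telescope_vec (Suc n) $ r) n = 0"
    using degree_adj_char_poly_matrix_mult_lift_vec[OF walk_vec_carrier r, of "Suc n"]
    by (simp add: coeff_monom_mult coeff_eq_0 del: telescope_vec.simps)
  moreover have "coeff (\<chi> * telescope_vec (Suc n) $ r) n = (\<Sum>k\<le>n. coeff \<chi> k * walk_vec k $ r)"
  proof -
    have "coeff (telescope_vec (Suc n) $ r) (n - k) = walk_vec k $ r" if "k \<le> n" for k
    proof -
      have "coeff (telescope_vec (Suc n) $ r) (n - k)
          = (\<Sum>j<Suc n. if j = k then walk_vec j $ r else 0)"
        unfolding index_telescope_vec[OF r] coeff_sum using that
        by (intro sum.cong) (auto simp: coeff_monom)
      then show ?thesis using that by simp
    qed
    then show ?thesis unfolding coeff_mult by (intro sum.cong) auto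
  qed
  ultimately show ?thesis by simp
qed

text \<open>The telescoping identity paired with e. It shows that the characteristic polynomial and
  the single polynomial e.adj(xI - S)e determine all walk counts.\<close>

lemma char_poly_times_walk_series:
  "\<chi> * (\<Sum>k<m. monom (walk_count k) (m - 1 - k))
    = monom 1 m * (lift_vec (walk_vec 0) \<bullet> (adj_mat C *\<^sub>v lift_vec (walk_vec 0)))
      - lift_vec (walk_vec 0) \<bullet> (adj_mat C *\<^sub>v lift_vec (walk_vec m))"
proof -
  let ?e = "lift_vec (walk_vec 0)"
  note adj = adj_mat(1)[OF C_carrier]
  have "?e \<bullet> telescope_vec m = (\<Sum>r\<in>{0..<n}. \<Sum>k<m. [:1:] * monom (walk_vec k $ r) (m - 1 - k))"
    unfolding scalar_prod_def dim_telescope_vec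
    by (intro sum.cong refl) (simp add: index_telescope_vec all_one_vec_def one_pCons)
  also have "\<dots> = (\<Sum>k<m. \<Sum>r\<in>{0..<n}. monom (walk_vec k $ r) (m - 1 - k))"
    by (subst sum.swap) simp
  also have "\<dots> = (\<Sum>k<m. monom (walk_count k) (m - 1 - k))"
    by (intro sum.cong refl)
      (simp add: walk_count_def scalar_prod_def all_one_vec_def monom_sum)
  finally have 1: "?e \<bullet> telescope_vec m = (\<Sum>k<m. monom (walk_count k) (m - 1 - k))" .
  have "?e \<bullet> (\<chi> \<cdot>\<^sub>v telescope_vec m) = \<chi> * (?e \<bullet> telescope_vec m)"
    by (subst scalar_prod_smult_right) auto
  moreover have "?e \<bullet> (\<chi> \<cdot>\<^sub>v telescope_vec m)
      = ?e \<bullet> (monom 1 m \<cdot>\<^sub>v (adj_mat C *\<^sub>v ?e)) - ?e \<bullet> (adj_mat C *\<^sub>v lift_vec (walk_vec m))"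
    unfolding char_poly_smult_telescope_vec
    by (rule scalar_prod_minus_distrib[of _ n]) (use adj in auto)
  moreover have "?e \<bullet> (monom 1 m \<cdot>\<^sub>v (adj_mat C *\<^sub>v ?e)) = monom 1 m * (?e \<bullet> (adj_mat C *\<^sub>v ?e))"
    by (subst scalar_prod_smult_right) (use adj in auto)
  ultimately show ?thesis using 1 by simp
qed

text \<open>The matrix xI - (J - I - S) is the negative of (yI - S) + J at y = -1 - x.\<close>

lemma char_poly_compl:
  "char_poly (all_one_mat n - 1\<^sub>m n - S)
    = (-1) ^ n * (det (C + all_one_mat n) \<circ>\<^sub>p [:-1,-1:])"
proof -
  have hom: "comm_ring_hom (\<lambda>p::int poly. p \<circ>\<^sub>p [:-1,-1:])"
    by unfold_locales (auto simp: pcompose_add pcompose_mult)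
  have "char_poly_matrix (all_one_mat n - 1\<^sub>m n - S)
      = (-1) \<cdot>\<^sub>m map_mat (\<lambda>p. p \<circ>\<^sub>p [:-1,-1:]) (C + all_one_mat n)"
    by (rule eq_matI)
      (auto simp: char_poly_matrix_def all_one_mat_def pcompose_add pcompose_pCons)
  then show ?thesis
    unfolding char_poly_def
    by (simp add: comm_ring_hom.hom_det[OF hom] carrier_matD[OF all_one_mat_carrier])
qed

lemma degree_all_one_adj_lift:
  assumes x: "x \<in> carrier_vec n"
  shows "degree (lift_vec (walk_vec 0) \<bullet> (adj_mat C *\<^sub>v lift_vec x)) \<le> n - 1"
proof -
  have "degree ([:1::int:] * (adj_mat C *\<^sub>v lift_vec x) $ r) \<le> n - 1" if "r < n" for r
    using degree_adj_char_poly_matrix_mult_lift_vec[OF x that] by simp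
  then show ?thesis
    using adj_mat(1)[OF C_carrier] unfolding scalar_prod_def
    by (intro degree_sum_le) (auto simp: all_one_vec_def)
qed

lemma char_poly_nz: "\<chi> \<noteq> 0" and degree_char_poly: "degree \<chi> = n"
  using degree_monic_char_poly[OF S_carrier] by auto

end

text \<open>The spectrum of J - I - S gives det(xI - S + J), hence e.adj(xI - S)e after subtracting
  the characteristic polynomial. The difference \<open>d\<close> of the two truncated walk series,
  multiplied by that polynomial of degree n, then has degree at most n - 1, so \<open>d\<close> is
  zero.\<close>

theorem walk_counts_eq:
  assumes S: "S \<in> carrier_mat n n" and T: "T \<in> carrier_mat n n"
    and gc: "gen_cospectral n S T"
  shows "square_int_mat.walk_count n S k = square_int_mat.walk_count n T k"
proof -
  interpret S: square_int_mat n S by unfold_locales fact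
  interpret T: square_int_mat n T by unfold_locales fact
  have \<chi>: "char_poly S = char_poly T"
    using gc by (simp add: gen_cospectral_def cospectral_def)
  define D where "D = (\<lambda>A::int mat. det (char_poly_matrix A + all_one_mat n))"
  \<comment> \<open>The substitution x -> -1 - x is an involution and can be undone.\<close>
  have inv: "p \<circ>\<^sub>p [:-1,-1:] \<circ>\<^sub>p [:-1,-1:] = p" for p :: "int poly"
    by (simp add: pcompose_assoc[symmetric] pcompose_pCons)
  have "(-1) ^ n * (D S \<circ>\<^sub>p [:-1,-1:]) = (-1) ^ n * (D T \<circ>\<^sub>p [:-1,-1:])"
    using gc S.char_poly_compl T.char_poly_compl
    by (simp add: gen_cospectral_def cospectral_def D_def)
  then have "D S \<circ>\<^sub>p [:-1,-1:] = D T \<circ>\<^sub>p [:-1,-1:]" by simp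
  then have D: "D S = D T" using inv by metis
  define P where "P = (\<lambda>A::int mat. map_vec (\<lambda>a. [:a:]) (all_one_vec n)
    \<bullet> (adj_mat (char_poly_matrix A) *\<^sub>v map_vec (\<lambda>a. [:a:]) (all_one_vec n)))"
  have e: "map_vec (\<lambda>a::int. [:a:]) (all_one_vec n) = all_one_vec n"
    by (auto simp: all_one_vec_def one_pCons)
  have "D S = char_poly S + P S"
    unfolding D_def P_def e char_poly_def
    by (rule det_add_all_one_mat) (use S.char_poly_nz in \<open>auto simp: char_poly_def\<close>)
  moreover have "D T = char_poly T + P T"
    unfolding D_def P_def e char_poly_def
    by (rule det_add_all_one_mat) (use T.char_poly_nz in \<open>auto simp: char_poly_def\<close>)
  ultimately have P: "P S = P T" using D \<chi> by simp
  \<comment> \<open>With this length the walk count at \<open>k\<close> is the constant coefficient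
    of the truncated series.\<close>
  define m where "m = Suc k"
  define R where "R = (\<lambda>A walk_vec. map_vec (\<lambda>a::int. [:a:]) (all_one_vec n)
    \<bullet> (adj_mat (char_poly_matrix A) *\<^sub>v map_vec (\<lambda>a. [:a:]) walk_vec))"
  define d where "d = (\<Sum>j<m. monom (S.walk_count j) (m - 1 - j))
    - (\<Sum>j<m. monom (T.walk_count j) (m - 1 - j))"
  have "char_poly S * d = R T (T.walk_vec m) - R S (S.walk_vec m)"
    using S.char_poly_times_walk_series[of m] T.char_poly_times_walk_series[of m] P \<chi>
    by (simp add: d_def R_def P_def algebra_simps)
  moreover have "degree (R T (T.walk_vec m) - R S (S.walk_vec m)) \<le> n - 1"
    using S.degree_all_one_adj_lift[OF S.walk_vec_carrier, of m]
      T.degree_all_one_adj_lift[OF T.walk_vec_carrier, of m]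
    by (intro degree_diff_le) (auto simp: R_def)
  ultimately have deg: "degree (char_poly S * d) \<le> n - 1" by simp
  show ?thesis
  \<comment> \<open>For n = 0 the bound \<open>n - 1\<close> is truncated to 0 and gives no
    contradiction; there all counts are empty sums.\<close>
  proof (cases "n = 0")
    case True
    then show ?thesis unfolding S.walk_count_def T.walk_count_def scalar_prod_def S.dim_walk_vec T.dim_walk_vec by simp
  next
    case False
    have "d = 0"
    proof (rule ccontr)
      assume "d \<noteq> 0"
      then have "degree (char_poly S * d) \<ge> n"
        using S.char_poly_nz S.degree_char_poly by (simp add: degree_mult_eq)
      with deg False show False by simp
    qed
    then have "coeff (\<Sum>j<m. monom (S.walk_count j) (m - 1 - j)) 0
      = coeff (\<Sum>j<m. monom (T.walk_count j) (m - 1 - j)) 0"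
      by (simp add: d_def)
    moreover have "coeff (\<Sum>j<m. monom (f j) (m - 1 - j)) 0 = f k" for f :: "nat \<Rightarrow> int"
    proof -
      have "coeff (\<Sum>j<m. monom (f j) (m - 1 - j)) 0 = (\<Sum>j<m. if j = k then f j else 0)"
        unfolding coeff_sum by (intro sum.cong) (auto simp: m_def coeff_monom)
      then show ?thesis by (simp add: m_def)
    qed
    ultimately show ?thesis by simp
  qed
qed

section \<open>Rational orthogonal conjugation\<close>

context square_int_mat
begin

abbreviation "W \<equiv> walk_mat n S"

lemma W_carrier [simp]: "W \<in> carrier_mat n n"
  by (simp add: walk_mat_def)

lemma dim_W [simp]: "dim_row W = n" "dim_col W = n"
  by (simp_all add: walk_mat_def)

lemma index_W: "i < n \<Longrightarrow> j < n \<Longrightarrow> W $$ (i,j) = walk_vec j $ i"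
  by (simp add: walk_mat_def walk_vec_def)

lemma col_W: "j < n \<Longrightarrow> col W j = walk_vec j"
  by (rule eq_vecI) (auto simp: index_W)

lemma index_transpose_W_mult: "j < n \<Longrightarrow> (transpose_mat W *\<^sub>v x) $ j = walk_vec j \<bullet> x"
  by (simp add: col_W)

end

locale skew_int_mat = square_int_mat +
  assumes skew: "transpose_mat S = - S"
begin

lemma skew_scalar_prod:
  assumes x: "x \<in> carrier_vec n" and y: "y \<in> carrier_vec n"
  shows "(S *\<^sub>v x) \<bullet> y = - (x \<bullet> (S *\<^sub>v y))"
proof -
  have "(S *\<^sub>v x) \<bullet> y = y \<bullet> (S *\<^sub>v x)"
    using x y by (intro comm_scalar_prod[of _ n]) (auto intro!: mult_mat_vec_carrier[of _ n n])
  also have "\<dots> = (transpose_mat S *\<^sub>v y) \<bullet> x"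
    using transpose_vec_mult_scalar[OF S_carrier x y] by (rule sym)
  also have "\<dots> = - ((S *\<^sub>v y) \<bullet> x)" using x y by (simp add: skew)
  also have "(S *\<^sub>v y) \<bullet> x = x \<bullet> (S *\<^sub>v y)"
    using x y by (intro comm_scalar_prod[of _ n]) (auto intro!: mult_mat_vec_carrier[of _ n n])
  finally show ?thesis .
qed

lemma skew_isotropic:
  assumes x: "x \<in> carrier_vec n"
  shows "x \<bullet> (S *\<^sub>v x) = 0"
  using skew_scalar_prod[OF x x] comm_scalar_prod[OF x, of "S *\<^sub>v x"] x
  by (simp add: mult_mat_vec_carrier[of _ n n])

text \<open>Each S moved to the other side costs a sign. Hence walk counts fix both
  \<open>W\<^sup>T W\<close> and \<open>W\<^sup>T S W\<close>.\<close>

lemma walk_vec_scalar_walk_vec: "walk_vec i \<bullet> walk_vec j = (-1) ^ i * walk_count (i + j)"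
proof (induction i arbitrary: j)
  case 0
  then show ?case by (simp add: walk_count_def)
next
  case (Suc i)
  have "walk_vec (Suc i) \<bullet> walk_vec j = - (walk_vec i \<bullet> walk_vec (Suc j))"
    by (simp add: walk_vec_Suc skew_scalar_prod)
  then show ?case by (simp add: Suc)
qed

lemma index_gram: "i < n \<Longrightarrow> j < n \<Longrightarrow> (transpose_mat W * W) $$ (i,j) = (-1) ^ i * walk_count (i + j)"
  by (simp add: col_W walk_vec_scalar_walk_vec)

lemma index_skew_gram:
  assumes "i < n" "j < n"
  shows "(transpose_mat W * (S * W)) $$ (i,j) = (-1) ^ i * walk_count (Suc (i + j))"
proof -
  have "col (S * W) j = walk_vec (Suc j)"
    using assms by (subst col_mult2[OF S_carrier W_carrier]) (simp_all add: col_W walk_vec_Suc)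
  moreover have "row (transpose_mat W) i = walk_vec i" using assms by (simp add: col_W)
  moreover have "(transpose_mat W * (S * W)) $$ (i,j)
      = row (transpose_mat W) i \<bullet> col (S * W) j"
    by (rule index_mult_mat(1)) (simp_all add: assms)
  ultimately have "(transpose_mat W * (S * W)) $$ (i,j) = walk_vec i \<bullet> walk_vec (Suc j)"
    by (simp only:)
  then show ?thesis by (simp only: walk_vec_scalar_walk_vec add_Suc_right)
qed

end

section \<open>The matrix conjugating one generalized cospectral graph into another\<close>

lemma oriented_graph_skew: "oriented_graph n S \<Longrightarrow> skew_int_mat n S"
proof unfold_locales
  assume *: "oriented_graph n S"
  then show S: "S \<in> carrier_mat n n" by (simp add: oriented_graph_def)
  show "transpose_mat S = - S"
  proof (rule eq_matI)
    fix i j assume "i < dim_row (- S)" "j < dim_col (- S)"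
    then have ij: "i < n" "j < n" using S by auto
    then have "S $$ (j,i) = - S $$ (i,j)" using * unfolding oriented_graph_def by blast
    then show "transpose_mat S $$ (i,j) = (- S) $$ (i,j)" using S ij by simp
  qed (use S in auto)
qed

abbreviation rat_mat :: "int mat \<Rightarrow> rat mat" where
  "rat_mat \<equiv> map_mat rat_of_int"

lemma inverse_mat_ex:
  fixes B :: "'a :: field mat"
  assumes B: "B \<in> carrier_mat n n" and "det B \<noteq> 0"
  obtains B' where "B' \<in> carrier_mat n n" "B' * B = 1\<^sub>m n" "B * B' = 1\<^sub>m n"
proof -
  note adj = adj_mat[OF B]
  let ?B' = "inverse (det B) \<cdot>\<^sub>m adj_mat B"
  have "?B' * B = 1\<^sub>m n" "B * ?B' = 1\<^sub>m n"
    using adj assms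
    by (auto simp: mult_smult_assoc_mat[of _ n n _ n] mult_smult_distrib[of _ n n _ n])
  with that[of ?B'] adj(1) show ?thesis by simp
qed

text \<open>Q is W(S) W(T)^(-1). Equal Gram matrices make it orthogonal, equality of
  \<open>W\<^sup>T S W\<close> with its analogue for T makes it conjugate S to T, and it is regular
  because both walk matrices have first column e.\<close>

lemma regular_rat_orth_exists:
  assumes S: "oriented_graph n S" and T: "oriented_graph n T"
    and gc: "gen_cospectral n S T" and nz: "det (walk_mat n S) \<noteq> 0"
  obtains Q where "regular_rat_orth n Q"
    "transpose_mat Q * rat_of_int_mat S * Q = rat_of_int_mat T"
proof (cases "n = 0")
  case True
  show ?thesis
    by (rule that[of "1\<^sub>m n"])
      (use True S T in \<open>auto simp: regular_rat_orth_def oriented_graph_def rat_of_int_mat_def\<close>)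
next
  case False
  interpret S: skew_int_mat n S using S by (rule oriented_graph_skew)
  interpret T: skew_int_mat n T using T by (rule oriented_graph_skew)
  have walk_count: "S.walk_count k = T.walk_count k" for k
    using walk_counts_eq[OF S.S_carrier T.S_carrier gc] .
  have gram: "transpose_mat S.W * S.W = transpose_mat T.W * T.W"
    by (rule eq_matI) (simp_all add: S.index_gram T.index_gram walk_count del: index_mult_mat(1))
  have sgram: "transpose_mat S.W * (S * S.W) = transpose_mat T.W * (T * T.W)"
    by (rule eq_matI) (simp_all
      add: S.index_skew_gram T.index_skew_gram walk_count del: index_mult_mat(1))
  have "det S.W * det S.W = det T.W * det T.W"
    using arg_cong[OF gram, of det] by (simp add: det_mult[of _ n] det_transpose[of _ n])
  with nz have nzT: "det T.W \<noteq> 0" by auto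
  define A where "A = rat_mat S.W"
  define B where "B = rat_mat T.W"
  have A: "A \<in> carrier_mat n n" and B: "B \<in> carrier_mat n n" by (auto simp: A_def B_def)
  have RS: "rat_mat S \<in> carrier_mat n n" "rat_mat T \<in> carrier_mat n n" by auto
  have "det B \<noteq> 0" using nzT by (simp add: B_def of_int_hom.hom_det)
  then obtain B' where B': "B' \<in> carrier_mat n n" "B' * B = 1\<^sub>m n" "B * B' = 1\<^sub>m n"
    using inverse_mat_ex[OF B] by auto
  have tB': "transpose_mat B' \<in> carrier_mat n n" "transpose_mat B' * transpose_mat B = 1\<^sub>m n"
    using B' B transpose_mult[OF B B'(1)] by auto
  have gramR: "transpose_mat A * A = transpose_mat B * B"
    using arg_cong[OF gram, of rat_mat]
    by (simp add: A_def B_def of_int_hom.mat_hom_mult[of _ n n _ n] map_mat_transpose[symmetric])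
  have sgramR: "transpose_mat A * (rat_mat S * A) = transpose_mat B * (rat_mat T * B)"
    using arg_cong[OF sgram, of rat_mat]
    by (simp add: mult_carrier_mat[of _ n n] A_def B_def of_int_hom.mat_hom_mult[of _ n n _ n] map_mat_transpose[symmetric])
  define Q where "Q = A * B'"
  have Q: "Q \<in> carrier_mat n n" and tQ: "transpose_mat Q = transpose_mat B' * transpose_mat A"
    using A B' by (auto simp: Q_def transpose_mult[of _ n n _ n])
  \<comment> \<open>Used twice: with the identity for X and Y it gives orthogonality, with S and T
    the conjugation.\<close>
  have conj: "transpose_mat Q * X * Q = Y"
    if "transpose_mat A * (X * A) = transpose_mat B * (Y * B)"
      and X: "X \<in> carrier_mat n n" and Y: "Y \<in> carrier_mat n n" for X Y
  proof -
    have "transpose_mat Q * X * Q = transpose_mat B' * (transpose_mat A * (X * A)) * B'"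
      unfolding tQ unfolding Q_def using A B' X
      by (simp add: assoc_mult_mat[of _ n n _ n _ n] mult_carrier_mat[of _ n n])
    also have "\<dots> = (transpose_mat B' * transpose_mat B) * Y * (B * B')"
      unfolding that(1) using B B' Y
      by (simp add: assoc_mult_mat[of _ n n _ n _ n] mult_carrier_mat[of _ n n])
    also have "\<dots> = Y" using Y tB' B' by simp
    finally show ?thesis .
  qed
  have "transpose_mat Q * 1\<^sub>m n * Q = 1\<^sub>m n"
    by (rule conj) (use gramR A B in auto)
  then have orth: "transpose_mat Q * Q = 1\<^sub>m n" using Q by simp
  have "A *\<^sub>v unit_vec n 0 = all_one_vec n" "B *\<^sub>v unit_vec n 0 = all_one_vec n"
    using False by (auto simp: A_def B_def S.index_W T.index_W
        scalar_prod_right_unit intro!: eq_vecI)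
  then have A0: "A *\<^sub>v unit_vec n 0 = all_one_vec n"
    and "Q *\<^sub>v all_one_vec n = Q *\<^sub>v (B *\<^sub>v unit_vec n 0)" by auto
  note this(2)
  also have "Q *\<^sub>v (B *\<^sub>v unit_vec n 0) = A *\<^sub>v (B' *\<^sub>v (B *\<^sub>v unit_vec n 0))"
    unfolding Q_def using A B B' by (intro assoc_mult_mat_vec) auto
  also have "B' *\<^sub>v (B *\<^sub>v unit_vec n 0) = unit_vec n 0"
    using assoc_mult_mat_vec[OF B'(1) B, of "unit_vec n 0"] B'(2) by simp
  also note A0
  finally have "regular_rat_orth n Q" using orth Q by (simp add: regular_rat_orth_def)
  moreover have "transpose_mat Q * rat_of_int_mat S * Q = rat_of_int_mat T"
    unfolding rat_of_int_mat_def by (rule conj[OF sgramR RS])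
  ultimately show ?thesis by (rule that)
qed

text \<open>An integral stand-in for a regular rational orthogonal Q: \<open>M\<close> is l Q, so
  the vectors M x / l with x integral form the lattice spanned by the columns of Q.\<close>

locale scaled_conj = S: skew_int_mat n S + T: skew_int_mat n T for n S T +
  fixes M :: "int mat" and l :: int
  assumes M_carrier [simp]: "M \<in> carrier_mat n n"
    and l_nz: "l \<noteq> 0"
    and gram: "transpose_mat M * M = (l * l) \<cdot>\<^sub>m 1\<^sub>m n"
    and conj: "S * M = M * T"
    and all_one: "M *\<^sub>v all_one_vec n = l \<cdot>\<^sub>v all_one_vec n"
begin

lemma dim_M [simp]: "dim_row M = n" "dim_col M = n"
  by (rule carrier_matD[OF M_carrier])+

lemma mult_M_carrier [simp]: "x \<in> carrier_vec n \<Longrightarrow> M *\<^sub>v x \<in> carrier_vec n"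
  by (rule mult_mat_vec_carrier[OF M_carrier])

lemma mult_walk_vec: "M *\<^sub>v T.walk_vec k = l \<cdot>\<^sub>v S.walk_vec k"
proof (induction k)
  case 0
  then show ?case by (simp add: all_one)
next
  case (Suc k)
  have "M *\<^sub>v T.walk_vec (Suc k) = (M * T) *\<^sub>v T.walk_vec k"
    by (simp add: T.walk_vec_Suc assoc_mult_mat_vec[of _ n n _ n])
  also have "\<dots> = S *\<^sub>v (M *\<^sub>v T.walk_vec k)"
    by (simp add: conj[symmetric] assoc_mult_mat_vec[of _ n n _ n])
  also have "\<dots> = l \<cdot>\<^sub>v S.walk_vec (Suc k)"
    unfolding Suc by (simp add: S.walk_vec_Suc mult_mat_smult_vec[of _ n n])
  finally show ?case .
qed

lemma gram_vec:
  assumes "x \<in> carrier_vec n"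
  shows "transpose_mat M *\<^sub>v (M *\<^sub>v x) = (l * l) \<cdot>\<^sub>v x"
proof -
  have "transpose_mat M *\<^sub>v (M *\<^sub>v x) = (transpose_mat M * M) *\<^sub>v x"
    using assms by (simp add: assoc_mult_mat_vec[of _ n n _ n])
  then show ?thesis using assms by (simp add: gram smult_mat_mult_vec[of _ n n])
qed

lemma scalar_prod_M:
  assumes x: "x \<in> carrier_vec n" and y: "y \<in> carrier_vec n"
  shows "(M *\<^sub>v x) \<bullet> (M *\<^sub>v y) = l * l * (x \<bullet> y)"
proof -
  have "(M *\<^sub>v x) \<bullet> (M *\<^sub>v y) = (transpose_mat M *\<^sub>v (M *\<^sub>v x)) \<bullet> y"
    using x y by (intro transpose_vec_mult_scalar[symmetric]) auto
  also have "\<dots> = l * l * (x \<bullet> y)"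
    unfolding gram_vec[OF x] using x y by simp
  finally show ?thesis .
qed

text \<open>Q takes T^k e to S^k e, so its transpose takes S^k e back to an integral vector.
  Consequently the columns of \<open>M\<close> lie in the kernel of \<open>W\<^sup>T\<close> modulo
  \<open>l\<close>, which is how the level is tied to the walk matrix.\<close>

lemma walk_vec_scalar_col:
  assumes x: "x \<in> carrier_vec n"
  shows "S.walk_vec k \<bullet> (M *\<^sub>v x) = l * (T.walk_vec k \<bullet> x)"
proof -
  have "l * (S.walk_vec k \<bullet> (M *\<^sub>v x)) = (M *\<^sub>v T.walk_vec k) \<bullet> (M *\<^sub>v x)"
    unfolding mult_walk_vec by (subst smult_scalar_prod_distrib[of _ n]) (use x in auto)
  also have "\<dots> = l * (l * (T.walk_vec k \<bullet> x))" using scalar_prod_M[OF _ x] by simp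
  finally show ?thesis using l_nz by simp
qed

lemma S_mult_M: "x \<in> carrier_vec n \<Longrightarrow> S *\<^sub>v (M *\<^sub>v x) = M *\<^sub>v (T *\<^sub>v x)"
  by (simp add: assoc_mult_mat_vec[of _ n n _ n, symmetric] conj)

lemma pow_S_mult_M:
  assumes x: "x \<in> carrier_vec n"
  shows "S ^\<^sub>m k *\<^sub>v (M *\<^sub>v x) = M *\<^sub>v (T ^\<^sub>m k *\<^sub>v x)"
proof (induction k)
  case 0
  show ?case using x by (simp add: one_mult_mat_vec[of _ n])
next
  case (Suc k)
  have "S ^\<^sub>m Suc k *\<^sub>v (M *\<^sub>v x) = S *\<^sub>v (S ^\<^sub>m k *\<^sub>v (M *\<^sub>v x))"
    unfolding S.pow_Suc_left using x by (intro assoc_mult_mat_vec) auto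
  also have "\<dots> = M *\<^sub>v (T *\<^sub>v (T ^\<^sub>m k *\<^sub>v x))"
    unfolding Suc using x by (intro S_mult_M) (auto intro!: mult_mat_vec_carrier[of _ n n])
  also have "T *\<^sub>v (T ^\<^sub>m k *\<^sub>v x) = T ^\<^sub>m Suc k *\<^sub>v x"
    unfolding T.pow_Suc_left using x by (intro assoc_mult_mat_vec[symmetric]) auto
  finally show ?case .
qed

end

section \<open>Polynomials acting on the all-one vector\<close>

definition vec_dvd :: "int \<Rightarrow> int vec \<Rightarrow> bool" where
  "vec_dvd k x \<longleftrightarrow> (\<forall>i<dim_vec x. k dvd x $ i)"

lemma vec_dvd_scalar_prod: "vec_dvd k x \<Longrightarrow> k dvd y \<bullet> x"
  by (auto simp: vec_dvd_def scalar_prod_def intro!: dvd_sum)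

lemma vec_dvd_mult_mat: "vec_dvd k x \<Longrightarrow> vec_dvd k (A *\<^sub>v x)"
  using vec_dvd_scalar_prod by (auto simp: vec_dvd_def)

lemma vec_dvd_add:
  "vec_dvd k x \<Longrightarrow> vec_dvd k y \<Longrightarrow> dim_vec x = dim_vec y \<Longrightarrow> vec_dvd k (x + y)"
  by (auto simp: vec_dvd_def)

lemma vec_dvd_smult: "vec_dvd k x \<Longrightarrow> vec_dvd k (c \<cdot>\<^sub>v x)"
  by (auto simp: vec_dvd_def)

lemma vec_dvd_smult_self: "vec_dvd k (k \<cdot>\<^sub>v x)"
  by (auto simp: vec_dvd_def)

lemma vec_dvd_smult_cancel:
  "coprime k c \<Longrightarrow> vec_dvd k (c \<cdot>\<^sub>v x) \<Longrightarrow> vec_dvd k x"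
  by (auto simp: vec_dvd_def coprime_dvd_mult_right_iff)

lemma vec_dvdE:
  assumes "vec_dvd k x" "x \<in> carrier_vec n"
  obtains y where "y \<in> carrier_vec n" "x = k \<cdot>\<^sub>v y"
proof
  show "vec n (\<lambda>i. x $ i div k) \<in> carrier_vec n" by simp
  show "x = k \<cdot>\<^sub>v vec n (\<lambda>i. x $ i div k)"
    using assms by (auto simp: vec_dvd_def)
qed

lemma adj_mat_mult_mult:
  fixes A :: "'a :: comm_ring_1 mat"
  assumes A: "A \<in> carrier_mat n n" and x: "x \<in> carrier_vec n"
  shows "adj_mat A *\<^sub>v (A *\<^sub>v x) = det A \<cdot>\<^sub>v x"
    and "A *\<^sub>v (adj_mat A *\<^sub>v x) = det A \<cdot>\<^sub>v x"
proof -
  note adj = adj_mat[OF A]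
  show "adj_mat A *\<^sub>v (A *\<^sub>v x) = det A \<cdot>\<^sub>v x"
    using assoc_mult_mat_vec[OF adj(1) A x] x
    by (simp add: adj(3) smult_mat_mult_vec[of _ n n])
  show "A *\<^sub>v (adj_mat A *\<^sub>v x) = det A \<cdot>\<^sub>v x"
    using assoc_mult_mat_vec[OF A adj(1) x] x
    by (simp add: adj(2) smult_mat_mult_vec[of _ n n])
qed

lemma mult_mat_vec_cancel:
  fixes A :: "'a :: idom mat"
  assumes A: "A \<in> carrier_mat n n" and nz: "det A \<noteq> 0"
    and x: "x \<in> carrier_vec n" and y: "y \<in> carrier_vec n" and eq: "A *\<^sub>v x = A *\<^sub>v y"
  shows "x = y"
proof (rule eq_vecI)
  have "det A \<cdot>\<^sub>v x = det A \<cdot>\<^sub>v y"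
    using adj_mat_mult_mult(1)[OF A x] adj_mat_mult_mult(1)[OF A y] eq by simp
  then have "(det A \<cdot>\<^sub>v x) $ i = (det A \<cdot>\<^sub>v y) $ i" for i by simp
  then show "x $ i = y $ i" if "i < dim_vec y" for i
    using that nz x y by (metis carrier_vecD index_smult_vec(1) mult_cancel_left)
qed (use x y in auto)

text \<open>The linear functional on polynomials that takes the value \<open>s k\<close> at x^k.
  With the walk counts for \<open>s\<close> it computes e.p(S)e.\<close>

definition lin :: "(nat \<Rightarrow> int) \<Rightarrow> int poly \<Rightarrow> int" where
  "lin s p = (\<Sum>k\<le>degree p. coeff p k * s k)"

lemma lin_eq: "degree p \<le> N \<Longrightarrow> lin s p = (\<Sum>k\<le>N. coeff p k * s k)"
  unfolding lin_def by (rule sum.mono_neutral_left) (auto simp: coeff_eq_0)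

lemma lin_0 [simp]: "lin s 0 = 0"
  by (simp add: lin_def)

lemma lin_add: "lin s (p + q) = lin s p + lin s q"
proof -
  define N where "N = max (degree p) (degree q)"
  have "degree (p + q) \<le> N" "degree p \<le> N" "degree q \<le> N"
    using degree_add_le_max[of p q] by (auto simp: N_def)
  then show ?thesis by (simp add: lin_eq[of _ N] sum.distrib ring_distribs)
qed

lemma lin_smult: "lin s (Polynomial.smult c p) = c * lin s p"
proof -
  have "degree (Polynomial.smult c p) \<le> degree p" by (rule degree_smult_le)
  then show ?thesis by (simp add: lin_eq[of _ "degree p"] sum_distrib_left mult.assoc)
qed

lemma lin_diff: "lin s (p - q) = lin s p - lin s q"
  using lin_add[of s p "- q"] lin_smult[of s "-1" q] by simp

lemma lin_pCons: "lin s (pCons a p) = a * s 0 + lin (\<lambda>k. s (Suc k)) p"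
proof -
  have "degree (pCons a p) \<le> Suc (degree p)" by (rule degree_pCons_le)
  then have "lin s (pCons a p) = (\<Sum>k\<le>Suc (degree p). coeff (pCons a p) k * s k)"
    by (rule lin_eq)
  also have "\<dots> = a * s 0 + lin (\<lambda>k. s (Suc k)) p"
    by (subst sum.atMost_Suc_shift) (simp add: lin_def)
  finally show ?thesis .
qed

lemma lin_const: "lin s [:a:] = a * s 0"
  by (simp add: lin_def)

text \<open>For skew S the adjoint of p(S) is p(-S); the other substitution, x^2 for x, is the
  Frobenius map modulo 2. The two meet in p(-x) p(x), which is p(x^2) modulo 2.\<close>

abbreviation subst_neg :: "int poly \<Rightarrow> int poly" where
  "subst_neg p \<equiv> p \<circ>\<^sub>p [:0,-1:]"

abbreviation subst_sq :: "int poly \<Rightarrow> int poly" where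
  "subst_sq p \<equiv> p \<circ>\<^sub>p monom 1 2"

text \<open>Only coefficients of odd degree change, each by an even amount. The vanishing constant
  term matters for odd n, where \<open>walk_count 0\<close> is odd.\<close>

lemma subst_neg_cong_mod_2: "\<exists>s. subst_neg p = p + Polynomial.smult 2 s \<and> coeff s 0 = 0"
proof (induction p)
  case (pCons a p)
  then obtain s where s: "subst_neg p = p + Polynomial.smult 2 s" by auto
  have "subst_neg (pCons a p) = pCons a p + Polynomial.smult 2 (pCons 0 (- p - s))"
    unfolding pcompose_pCons s
    by (rule poly_eqI) (simp add: coeff_pCons algebra_simps split: nat.splits)
  then show ?case by (intro exI[of _ "pCons 0 (- p - s)"]) simp
qed (auto intro: exI[of _ 0])

text \<open>In a square the mixed terms come in pairs, and a^2 has the parity of a.\<close>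

lemma square_cong_subst_sq_mod_2: "\<exists>t. p * p = subst_sq p + Polynomial.smult 2 t"
proof (induction p)
  case (pCons a p)
  then obtain t where t: "p * p = subst_sq p + Polynomial.smult 2 t" by auto
  have "even (a * a - a)" by simp
  then obtain b where b: "a * a = a + 2 * b" by (metis add.commute diff_eq_eq evenE)
  have x2: "monom 1 2 * q = pCons 0 (pCons 0 q)" for q :: "int poly"
    by (simp add: numeral_2_eq_2 monom_Suc monom_0)
  have two: "coeff (2 * q) i = 2 * coeff q i" for q :: "int poly" and i
    by (simp only: mult_2 coeff_add)
  have "pCons a p * pCons a p = [:a * a:] + pCons 0 (Polynomial.smult (2 * a) p)
    + pCons 0 (pCons 0 (p * p))"
    by (rule poly_eqI) (simp add: coeff_pCons two split: nat.splits)
  also have "\<dots> = subst_sq (pCons a p) + Polynomial.smult 2 ([:b:]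
    + pCons 0 (Polynomial.smult a p) + pCons 0 (pCons 0 t))"
    unfolding pcompose_pCons x2 t b by (simp add: smult_add_right)
  finally show ?case by blast
qed (auto intro: exI[of _ 0])

lemma coeff_subst_sq: "coeff (subst_sq p) k = (if even k then coeff p (k div 2) else 0)"
  using coeff_pcompose_monom[of "k mod 2" 2 p "k div 2"] by (simp add: even_iff_mod_2_eq_zero)

lemma subst_sq_ex:
  assumes "\<And>k. odd k \<Longrightarrow> coeff p k = (0::int)"
  obtains q where "subst_sq q = p"
proof -
  define q where "q = (\<Sum>i\<le>degree p. monom (coeff p (2 * i)) i)"
  have q: "coeff q i = coeff p (2 * i)" for i
  proof -
    have "coeff q i = (\<Sum>j\<le>degree p. if j = i then coeff p (2 * i) else 0)"
      unfolding q_def coeff_sum by (intro sum.cong) (auto simp: coeff_monom)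
    also have "\<dots> = coeff p (2 * i)" by (auto simp: coeff_eq_0)
    finally show ?thesis .
  qed
  have "subst_sq q = p"
    by (rule poly_eqI) (use assms in \<open>auto simp: coeff_subst_sq q\<close>)
  then show ?thesis by (rule that)
qed

context skew_int_mat
begin

text \<open>This is p(S) e, expanded in the walk vectors coordinate by coordinate.\<close>

definition act :: "int poly \<Rightarrow> int vec" where
  "act p = vec n (\<lambda>r. lin (\<lambda>k. walk_vec k $ r) p)"

lemma act_carrier [simp]: "act p \<in> carrier_vec n" and dim_act [simp]: "dim_vec (act p) = n"
  by (simp_all add: act_def)

lemma scalar_act:
  assumes u: "u \<in> carrier_vec n"
  shows "u \<bullet> act p = lin (\<lambda>k. u \<bullet> walk_vec k) p"
proof -
  have "u \<bullet> act p = (\<Sum>r\<in>{0..<n}. \<Sum>k\<le>degree p. coeff p k * (u $ r * walk_vec k $ r))"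
    unfolding scalar_prod_def dim_act
    by (intro sum.cong refl) (simp add: act_def lin_def sum_distrib_left mult.left_commute)
  also have "\<dots> = lin (\<lambda>k. u \<bullet> walk_vec k) p"
    unfolding lin_def by (subst sum.swap) (simp add: scalar_prod_def sum_distrib_left)
  finally show ?thesis .
qed

lemma all_one_scalar_act: "all_one_vec n \<bullet> act p = lin walk_count p"
  unfolding scalar_act[OF all_one_vec_carrier] by (simp add: walk_count_def[abs_def])

lemma act_0 [simp]: "act 0 = 0\<^sub>v n"
  by (auto simp: act_def)

lemma act_add: "act (p + q) = act p + act q"
  by (auto simp: act_def lin_add)

lemma act_diff: "act (p - q) = act p - act q"
  by (auto simp: act_def lin_diff)

lemma act_smult: "act (Polynomial.smult c p) = c \<cdot>\<^sub>v act p"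
  by (auto simp: act_def lin_smult)

lemma act_pCons: "act (pCons a p) = a \<cdot>\<^sub>v all_one_vec n + S *\<^sub>v act p"
proof (rule eq_vecI)
  fix r assume "r < dim_vec (a \<cdot>\<^sub>v all_one_vec n + S *\<^sub>v act p)"
  then have r: "r < n" by simp
  have row: "row S r \<in> carrier_vec n" using row_carrier[of S r] by simp
  have "(S *\<^sub>v act p) $ r = lin (\<lambda>k. walk_vec (Suc k) $ r) p"
    using r scalar_act[OF row] by (simp add: walk_vec_Suc)
  then show "act (pCons a p) $ r = (a \<cdot>\<^sub>v all_one_vec n + S *\<^sub>v act p) $ r"
    using r by (simp add: act_def lin_pCons)
qed simp

lemma act_pCons_0: "act (pCons 0 p) = S *\<^sub>v act p"
  unfolding act_pCons by auto

lemma act_const: "act [:a:] = a \<cdot>\<^sub>v all_one_vec n"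
  by (auto simp: act_def lin_const)

lemma act_monom_mult: "act (monom 1 k * p) = S ^\<^sub>m k *\<^sub>v act p"
proof (induction k)
  case (Suc k)
  have "act (monom 1 (Suc k) * p) = S *\<^sub>v (S ^\<^sub>m k *\<^sub>v act p)"
    by (simp add: monom_Suc act_pCons_0 Suc)
  then show ?case
    unfolding pow_Suc_left by (simp add: assoc_mult_mat_vec[of _ n n _ n])
qed (simp add: monom_0 one_mult_mat_vec[of _ n])

lemma act_monom: "act (monom 1 k) = walk_vec k"
  using act_monom_mult[of k 1] act_const[of 1] by (simp add: walk_vec_def one_pCons)

lemma act_mult_pCons: "act (p * pCons a q) = a \<cdot>\<^sub>v act p + S *\<^sub>v act (p * q)"
  by (simp add: act_add act_smult act_pCons_0)

lemma vec_dvd_act_mult: "vec_dvd k (act p) \<Longrightarrow> vec_dvd k (act (p * q))"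
proof (induction q)
  case 0
  then show ?case by (simp add: vec_dvd_def)
next
  case (pCons a q)
  then show ?case unfolding act_mult_pCons
    by (intro vec_dvd_add vec_dvd_smult vec_dvd_mult_mat) auto
qed

lemma act_char_poly_mult: "act (\<chi> * q) = 0\<^sub>v n"
proof (induction q)
  case (pCons a q)
  have "act \<chi> = 0\<^sub>v n"
    by (rule eq_vecI)
      (use degree_char_poly char_poly_annihilates_all_one_vec in \<open>simp_all add: act_def lin_def\<close>)
  then show ?case unfolding act_mult_pCons pCons by auto
qed simp

lemma act_scalar_act: "act f \<bullet> act g = lin walk_count (subst_neg f * g)"
proof (induction f arbitrary: g)
  case (pCons a f)
  have "act (pCons a f) \<bullet> act g = (a \<cdot>\<^sub>v all_one_vec n) \<bullet> act g + (S *\<^sub>v act f) \<bullet> act g"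
    unfolding act_pCons by (rule add_scalar_prod_distrib[of _ n])
      (auto intro!: mult_mat_vec_carrier[of _ n n])
  also have "\<dots> = a * lin walk_count g - act f \<bullet> act (pCons 0 g)"
    unfolding act_pCons_0 skew_scalar_prod[OF act_carrier act_carrier]
    by (simp add: all_one_scalar_act)
  also have "\<dots> = lin walk_count (Polynomial.smult a g - subst_neg f * pCons 0 g)"
    unfolding pCons by (simp only: lin_diff lin_smult)
  also have "Polynomial.smult a g - subst_neg f * pCons 0 g = subst_neg (pCons a f) * g"
    by (simp add: pcompose_pCons algebra_simps)
  finally show ?case .
qed simp

lemma act_eq_walk_mult:
  assumes "degree p < n"
  shows "act p = W *\<^sub>v vec n (coeff p)"
proof (rule eq_vecI)
  fix r assume "r < dim_vec (W *\<^sub>v vec n (coeff p))"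
  then have r: "r < n" by simp
  have "act p $ r = (\<Sum>k\<le>n-1. coeff p k * walk_vec k $ r)"
    using assms r by (simp add: act_def lin_eq[of p "n-1"])
  also have "{..n-1} = {0..<n}" using r by auto
  finally show "act p $ r = (W *\<^sub>v vec n (coeff p)) $ r"
    using r by (simp add: scalar_prod_def index_W mult.commute)
qed simp

section \<open>Parity of the walk counts\<close>

lemma walk_count_0: "walk_count 0 = int n"
  by (simp add: walk_count_def scalar_prod_def)

lemma walk_count_odd: "odd k \<Longrightarrow> walk_count k = 0"
  using walk_vec_scalar_walk_vec[of 0 k] walk_vec_scalar_walk_vec[of k 0] comm_scalar_prod[OF walk_vec_carrier walk_vec_carrier, of 0 k]
  by simp

text \<open>For k = 2j the count is, up to sign, the squared length of S^j e. Modulo 2 that is the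
  sum of its entries, the count at j, which is even by induction.\<close>

lemma walk_count_even: "0 < k \<Longrightarrow> even (walk_count k)"
proof (induction k rule: less_induct)
  case (less k)
  show ?case
  proof (cases "even k")
    case True
    then obtain j where k: "k = j + j" by (metis evenE mult_2)
    have "even (walk_vec j \<bullet> walk_vec j - all_one_vec n \<bullet> walk_vec j)"
      unfolding scalar_prod_def dim_walk_vec sum_subtractf[symmetric]
      by (intro dvd_sum) (simp add: all_one_vec_def)
    moreover have "even (walk_count j)" using less k by auto
    moreover have "walk_vec j \<bullet> walk_vec j = (-1) ^ j * walk_count k"
      using walk_vec_scalar_walk_vec[of j j] k by simp
    ultimately show ?thesis by (cases "even j") (auto simp: walk_count_def[symmetric])
  qed (simp add: walk_count_odd)
qed

text \<open>The count at 0 is n, the only one that can be odd. This is the source of the side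
  conditions on constant coefficients in the odd case.\<close>

lemma lin_walk_count_even: "even n \<or> coeff p 0 = 0 \<Longrightarrow> even (lin walk_count p)"
  unfolding lin_def
proof (intro dvd_sum)
  fix k assume "even n \<or> coeff p 0 = 0"
  then show "even (coeff p k * walk_count k)"
    by (cases "k = 0") (auto simp: walk_count_0 walk_count_even)
qed

lemma lin_walk_count_monom_odd: "odd k \<Longrightarrow> lin walk_count (monom 1 k * subst_sq p) = 0"
  unfolding lin_def
proof (intro sum.neutral ballI)
  fix i assume "odd k"
  then show "coeff (monom 1 k * subst_sq p) i * walk_count i = 0"
    by (cases "even i") (auto simp: coeff_monom_mult coeff_subst_sq walk_count_odd)
qed

lemma char_poly_parity: "coeff \<chi> k = (-1) ^ (n + k) * coeff \<chi> k"
proof -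
  have hom: "comm_ring_hom (\<lambda>p::int poly. p \<circ>\<^sub>p [:0,-1:])"
    by unfold_locales (auto simp: pcompose_add pcompose_mult)
  have "char_poly_matrix (- S) = (-1) \<cdot>\<^sub>m map_mat subst_neg C"
    by (rule eq_matI) (auto simp: char_poly_matrix_def pcompose_add pcompose_pCons)
  then have "char_poly (- S) = (-1) ^ n * subst_neg \<chi>"
    unfolding char_poly_def by (simp add: comm_ring_hom.hom_det[OF hom])
  moreover have "char_poly (- S) = \<chi>"
    using char_poly_transpose_mat[OF S_carrier] by (simp add: skew)
  ultimately have *: "\<chi> = (-1) ^ n * subst_neg \<chi>" by simp
  have "coeff ((-1) ^ n * subst_neg \<chi>) k = (-1) ^ n * coeff (subst_neg \<chi>) k"
    by (cases "even n") auto
  then have "coeff \<chi> k = (-1) ^ n * coeff (subst_neg \<chi>) k"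
    using * by simp
  then show ?thesis by (simp add: coeff_pcompose_linear power_add)
qed

text \<open>As \<open>S\<close> is skew, its characteristic polynomial has the parity of \<open>n\<close>. Modulo 2 the polynomial \<open>m\<close>
  below is a square root of it (times \<open>x\<close> for odd \<open>n\<close>),
    and it annihilates the all-one vector modulo 2.\<close>

lemma half_char_poly_ex:
  obtains m where "subst_sq m = monom 1 (n mod 2) * \<chi>" "lead_coeff m = 1"
    "2 * degree m = n + n mod 2" "odd n \<Longrightarrow> coeff m 0 = 0"
proof -
  let ?P = "monom 1 (n mod 2) * \<chi>"
  have "coeff ?P k = 0" if "odd k" for k
  proof (cases "k < n mod 2")
    case False
    then have "odd (n + (k - n mod 2))" using that by (cases "even n")
      (auto simp: odd_iff_mod_2_eq_one)
    then have "coeff \<chi> (k - n mod 2) = - coeff \<chi> (k - n mod 2)"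
      using char_poly_parity[of "k - n mod 2"] by simp
    then show ?thesis by (simp add: coeff_monom_mult)
  qed (simp add: coeff_monom_mult)
  then obtain m where m: "subst_sq m = ?P" using subst_sq_ex by blast
  have deg: "degree ?P = n + n mod 2"
    using char_poly_nz degree_char_poly by (simp add: degree_mult_eq degree_monom_eq)
  have "degree (subst_sq m) = degree m * 2"
    by (simp add: degree_pcompose degree_monom_eq)
  then have dm: "2 * degree m = n + n mod 2" using m deg by simp
  have "coeff ?P (n + n mod 2) = 1"
    using degree_monic_char_poly[OF S_carrier] by (simp add: coeff_monom_mult)
  moreover have "coeff ?P (n + n mod 2) = coeff m (degree m)"
    using coeff_subst_sq[of m "2 * degree m"] unfolding m by (simp add: dm[symmetric])
  ultimately have "coeff m (degree m) = 1" by simp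
  moreover have "coeff m 0 = 0" if "odd n"
    using m coeff_subst_sq[of m 0] that by (simp add: coeff_monom_mult odd_iff_mod_2_eq_one)
  ultimately show ?thesis using that m dm by blast
qed

end

section \<open>The prime two\<close>

locale walk_two = skew_int_mat +
  fixes b :: int
  assumes n_pos: "0 < n"
    and det_W: "det W = 2 ^ (n div 2) * b"
    and odd_b: "odd b"
begin

text \<open>All entries of \<open>W\<^sup>T W\<close> are even except \<open>n\<close> itself in the corner when \<open>n\<close> is odd; halving the even
  rows leaves a matrix \<open>K\<close> of odd determinant.\<close>

definition gram_div :: "nat \<Rightarrow> int" where
  "gram_div i = (if i = 0 \<and> odd n then 1 else 2)"

definition K :: "int mat" where
  "K = mat n n (\<lambda>(i,j). ((-1) ^ i * walk_count (i + j)) div gram_div i)"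

lemma K_carrier [simp]: "K \<in> carrier_mat n n"
  by (simp add: K_def)

lemma dim_K [simp]: "dim_row K = n" "dim_col K = n"
  by (simp_all add: K_def)

lemma gram_div_dvd: "gram_div i dvd (-1) ^ i * walk_count (i + j)"
  by (cases "i + j = 0") (auto simp: gram_div_def walk_count_0 walk_count_even)

lemma index_K: "i < n \<Longrightarrow> j < n \<Longrightarrow> gram_div i * K $$ (i,j) = (-1) ^ i * walk_count (i + j)"
  using gram_div_dvd[of i j] by (simp add: K_def)

lemma gram_div_K_mult:
  assumes x: "x \<in> carrier_vec n" and i: "i < n"
  shows "gram_div i * (K *\<^sub>v x) $ i = walk_vec i \<bullet> (W *\<^sub>v x)"
proof -
  have "walk_vec i \<bullet> (W *\<^sub>v x) = ((transpose_mat W * W) *\<^sub>v x) $ i"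
    using x i index_transpose_W_mult[of i "W *\<^sub>v x"]
    by (simp add: assoc_mult_mat_vec[of _ n n _ n])
  also have "\<dots> = (\<Sum>j\<in>{0..<n}. (-1) ^ i * walk_count (i + j) * x $ j)"
    using x i index_gram[OF i] by (simp add: scalar_prod_def)
  also have "\<dots> = (\<Sum>j\<in>{0..<n}. gram_div i * (K $$ (i,j) * x $ j))"
    using i by (intro sum.cong) (simp_all add: index_K[symmetric])
  also have "\<dots> = gram_div i * (K *\<^sub>v x) $ i"
    using x i by (simp add: scalar_prod_def sum_distrib_left)
  finally show ?thesis ..
qed

lemma det_K: "det K = b * b"
proof -
  have "mat_diag n gram_div * K = transpose_mat W * W"
    unfolding mat_diag_mult_left[OF K_carrier]
    by (rule eq_matI) (simp_all add: index_K index_gram del: index_mult_mat(1))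
  then have "det (mat_diag n gram_div) * det K = det W * det W"
    using det_mult[of "mat_diag n gram_div" n K] det_mult[of "transpose_mat W" n W]
    by (simp add: det_transpose[of _ n])
  \<comment> \<open>There are n halved rows for even n and n - 1 for odd n. Either way the power of
    2 removed is exactly the one in the square of det W, which leaves b^2.\<close>
  moreover have "det (mat_diag n gram_div) = 2 ^ (n div 2) * 2 ^ (n div 2)"
  proof -
    have "det (mat_diag n gram_div) = (\<Prod>i\<in>{0..<n}. gram_div i)"
      by (subst det_upper_triangular[of _ n])
        (auto simp: mat_diag_def prod_list_diag_prod upper_triangular_def)
    also have "\<dots> = gram_div 0 * (\<Prod>i\<in>{1..<n}. 2)"
      using n_pos by (subst prod.atLeast_Suc_lessThan) (auto simp: gram_div_def)
    also have "\<dots> = 2 ^ (n div 2 + n div 2)"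
    proof (cases "even n")
      case True
      then have "Suc (n - 1) = n div 2 + n div 2" using n_pos by presburger
      with True show ?thesis by (simp add: gram_div_def flip: power_Suc)
    next
      case False
      then have "n - 1 = n div 2 + n div 2" by presburger
      with False show ?thesis by (simp add: gram_div_def)
    qed
    finally show ?thesis by (simp add: power_add)
  qed
  ultimately show ?thesis by (simp add: det_W)
qed

lemma odd_det_K: "odd (det K)"
  using odd_b by (simp add: det_K)

lemma det_W_nz: "det W \<noteq> 0"
  using odd_b by (auto simp: det_W)

text \<open>With g the suitably halved vector \<open>W\<^sup>T u\<close>, the equation K c = (det K)
  g is solved by the adjugate, and cancelling \<open>W\<^sup>T\<close> gives W c = (det K) u with
  det K odd. For odd n the pairing of W c with e is n c_0 plus even terms, so c_0 is even.\<close>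

lemma even_walk_coords:
  assumes u: "u \<in> carrier_vec n" and even: "\<And>j. j < n \<Longrightarrow> even (walk_vec j \<bullet> u)"
  obtains a c where "odd a" "c \<in> carrier_vec n" "a \<cdot>\<^sub>v u = W *\<^sub>v c" "odd n \<Longrightarrow> even (c $ 0)"
proof -
  define g where "g = vec n (\<lambda>i. (walk_vec i \<bullet> u) div gram_div i)"
  have g: "g \<in> carrier_vec n" by (simp add: g_def)
  have gi: "gram_div i * g $ i = walk_vec i \<bullet> u" if "i < n" for i
    using even[OF that] that by (auto simp: g_def gram_div_def)
  define c where "c = adj_mat K *\<^sub>v g"
  have c: "c \<in> carrier_vec n" using adj_mat(1)[OF K_carrier] g by (simp
    add: c_def mult_mat_vec_carrier[of _ n n])
  have Kc: "K *\<^sub>v c = det K \<cdot>\<^sub>v g"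
    unfolding c_def by (rule adj_mat_mult_mult(2)[OF K_carrier g])
  have tW: "transpose_mat W \<in> carrier_mat n n" by simp
  have "transpose_mat W *\<^sub>v (W *\<^sub>v c) = transpose_mat W *\<^sub>v (det K \<cdot>\<^sub>v u)"
  proof (rule eq_vecI)
    fix i assume "i < dim_vec (transpose_mat W *\<^sub>v (det K \<cdot>\<^sub>v u))"
    then have i: "i < n" by simp
    have "(transpose_mat W *\<^sub>v (W *\<^sub>v c)) $ i = gram_div i * (det K * g $ i)"
      unfolding index_transpose_W_mult[OF i] gram_div_K_mult[OF c i, symmetric] Kc
      using i g by simp
    also have "\<dots> = det K * (walk_vec i \<bullet> u)" using gi[OF i] by (simp add: mult.left_commute)
    also have "\<dots> = (transpose_mat W *\<^sub>v (det K \<cdot>\<^sub>v u)) $ i"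
      unfolding index_transpose_W_mult[OF i] using u by simp
    finally show "(transpose_mat W *\<^sub>v (W *\<^sub>v c)) $ i = (transpose_mat W *\<^sub>v (det K \<cdot>\<^sub>v u)) $ i" .
  qed simp
  then have eq: "W *\<^sub>v c = det K \<cdot>\<^sub>v u"
    using mult_mat_vec_cancel[OF tW] det_W_nz u c
    by (simp add: det_transpose[of _ n] mult_mat_vec_carrier[of _ n n])
  have "even (c $ 0)" if "odd n"
  proof -
    have "even (walk_vec 0 \<bullet> (W *\<^sub>v c))"
      unfolding eq using even[OF n_pos] u by simp
    also have "walk_vec 0 \<bullet> (W *\<^sub>v c) = (\<Sum>j\<in>{0..<n}. walk_count j * c $ j)"
    proof -
      have "walk_vec 0 \<bullet> (W *\<^sub>v c) = ((transpose_mat W * W) *\<^sub>v c) $ 0"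
        using c n_pos index_transpose_W_mult[of 0 "W *\<^sub>v c"]
        by (simp add: assoc_mult_mat_vec[of _ n n _ n])
      then show ?thesis using c n_pos index_gram[OF n_pos] by (simp add: scalar_prod_def)
    qed
    also have "\<dots> = walk_count 0 * c $ 0 + (\<Sum>j\<in>{1..<n}. walk_count j * c $ j)"
      using n_pos by (subst sum.atLeast_Suc_lessThan) auto
    finally have "even (walk_count 0 * c $ 0 + (\<Sum>j\<in>{1..<n}. walk_count j * c $ j))" .
    moreover have "even (\<Sum>j\<in>{1..<n}. walk_count j * c $ j)"
      by (intro dvd_sum) (auto simp: walk_count_even)
    ultimately show ?thesis using that by (simp add: walk_count_0)
  qed
  with that[OF odd_det_K c eq[symmetric]] show ?thesis by blast
qed

text \<open>Dividing the i-th pairing by \<open>gram_div i\<close>, which is 1 or 2, leaves K f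
  even, and K is invertible modulo 2.\<close>

lemma walk_coords_even:
  assumes f: "f \<in> carrier_vec n" and four: "\<And>k. k < n \<Longrightarrow> 4 dvd walk_vec k \<bullet> (W *\<^sub>v f)"
  shows "vec_dvd 2 f"
proof -
  have "vec_dvd 2 (K *\<^sub>v f)"
    unfolding vec_dvd_def
  proof safe
    fix i assume "i < dim_vec (K *\<^sub>v f)"
    then have i: "i < n" by simp
    have "4 dvd gram_div i * (K *\<^sub>v f) $ i"
      unfolding gram_div_K_mult[OF f i] by (rule four[OF i])
    then show "2 dvd (K *\<^sub>v f) $ i"
      unfolding gram_div_def by (auto split: if_splits elim: dvd_trans[rotated])
  qed
  then have "vec_dvd 2 (det K \<cdot>\<^sub>v f)"
    unfolding adj_mat_mult_mult(1)[OF K_carrier f, symmetric] by (rule vec_dvd_mult_mat)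
  then show ?thesis using odd_det_K vec_dvd_smult_cancel[of 2 "det K" f] by simp
qed

lemma scalar_pow_S_comm:
  assumes u: "u \<in> carrier_vec n" and v: "v \<in> carrier_vec n"
  shows "(S ^\<^sub>m k *\<^sub>v u) \<bullet> v = (-1) ^ k * (u \<bullet> (S ^\<^sub>m k *\<^sub>v v))"
  using v
proof (induction k arbitrary: v)
  case 0
  then show ?case using u by (simp add: one_mult_mat_vec[of _ n])
next
  case (Suc k)
  have "(S ^\<^sub>m Suc k *\<^sub>v u) \<bullet> v = (S *\<^sub>v (S ^\<^sub>m k *\<^sub>v u)) \<bullet> v"
    unfolding pow_Suc_left using u by (simp add: assoc_mult_mat_vec[of _ n n _ n])
  also have "\<dots> = - ((S ^\<^sub>m k *\<^sub>v u) \<bullet> (S *\<^sub>v v))"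
    using u Suc.prems by (intro skew_scalar_prod) (auto intro!: mult_mat_vec_carrier[of _ n n])
  also have "\<dots> = - ((-1) ^ k * (u \<bullet> (S ^\<^sub>m k *\<^sub>v (S *\<^sub>v v))))"
    using Suc.prems by (subst Suc.IH) (auto intro!: mult_mat_vec_carrier[of _ n n])
  also have "S ^\<^sub>m k *\<^sub>v (S *\<^sub>v v) = S ^\<^sub>m Suc k *\<^sub>v v"
    using Suc.prems by (simp add: assoc_mult_mat_vec[of _ n n _ n])
  finally show ?case by simp
qed

lemma four_dvd_lin_walk_count:
  assumes "even (lin walk_count q)"
  shows "4 dvd lin walk_count (p + Polynomial.smult 2 q) \<longleftrightarrow> 4 dvd lin walk_count p"
  using assms unfolding lin_add lin_smult by presburger

text \<open>Up to an odd factor u is p(S) e; let q be p without its constant term if n is odd. For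
  even k the pairing of q(S) e with S^k q(S) e is the walk-count value of q(-x) q(x) x^k, which
  modulo 4 is that of x^k q(x^2). So q(S^2) e pairs to 0 modulo 4 with every walk vector. Division
  by the monic m leaves r with q(S^2) e = r(S^2) e, as m(x^2) is a multiple of the characteristic
  polynomial. By \<open>walk_coords_even\<close> the coefficients of r(x^2), hence of r, are
  even.\<close>

lemma half_poly_decomposition:
  assumes m: "subst_sq m = monom 1 (n mod 2) * \<chi>" "lead_coeff m = 1" "2 * degree m = n + n mod 2"
    and u: "u \<in> carrier_vec n"
    and even: "\<And>j. j < n \<Longrightarrow> even (walk_vec j \<bullet> u)"
    and four: "\<And>k. even k \<Longrightarrow> 4 dvd u \<bullet> (S ^\<^sub>m k *\<^sub>v u)"
  obtains a g r where "odd a" "a \<cdot>\<^sub>v u = act (m * g + Polynomial.smult 2 r)"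
proof -
  obtain a c where a: "odd a" and c: "c \<in> carrier_vec n" "a \<cdot>\<^sub>v u = W *\<^sub>v c"
    "odd n \<Longrightarrow> even (c $ 0)"
    using even_walk_coords[OF u even] by blast
  define p where "p = (\<Sum>i<n. monom (c $ i) i)"
  have coeff_p: "coeff p i = (if i < n then c $ i else 0)" for i
  proof -
    have "coeff p i = (\<Sum>j<n. if j = i then c $ i else 0)"
      unfolding p_def coeff_sum by (intro sum.cong) (auto simp: coeff_monom)
    then show ?thesis by simp
  qed
  have "degree p < n"
    using n_pos unfolding p_def
    by (intro degree_sum_less) (auto intro: le_less_trans[OF degree_monom_le])
  moreover have "vec n (coeff p) = c" using c by (auto simp: coeff_p)
  ultimately have act_p: "act p = a \<cdot>\<^sub>v u" using c(2) by (simp add: act_eq_walk_mult)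
  \<comment> \<open>For odd n the constant coefficient would meet the odd number
    \<open>walk_count 0\<close>. It is even and is split off, so that the correction terms below
    take even values; it returns in \<open>r'\<close>.\<close>
  define p0 where "p0 = (if odd n then coeff p 0 else 0)"
  have even_p0: "even p0" using c(3) n_pos by (simp add: p0_def coeff_p)
  define q where "q = p - [:p0:]"
  have q0: "even n \<or> coeff q 0 = 0" by (simp add: q_def p0_def)
  have act_q: "act q = a \<cdot>\<^sub>v u - p0 \<cdot>\<^sub>v walk_vec 0" by (simp add: q_def act_diff act_p act_const)
  \<comment> \<open>Splitting off the constant changes the pairing by a multiple of 4: the two cross
    terms agree because k is even, so together they carry 2 p0, and the last term carries
    p0^2.\<close>
  have four_q: "4 dvd act q \<bullet> (S ^\<^sub>m k *\<^sub>v act q)" if k: "even k" for k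
  proof -
    define v where "v = S ^\<^sub>m k *\<^sub>v u"
    have v: "v \<in> carrier_vec n" using u by (simp add: v_def mult_mat_vec_carrier[of _ n n])
    have walk_k: "S ^\<^sub>m k *\<^sub>v walk_vec 0 = walk_vec k" by (simp
      add: walk_vec_def one_mult_mat_vec[of _ n])
    have Sq: "S ^\<^sub>m k *\<^sub>v act q = a \<cdot>\<^sub>v v - p0 \<cdot>\<^sub>v walk_vec k"
      unfolding act_q v_def walk_k[symmetric] using u
      by (simp add: mult_minus_distrib_mat_vec[of _ n n] mult_mat_smult_vec[of _ n n])
    have "v \<bullet> walk_vec 0 = u \<bullet> walk_vec k"
      using scalar_pow_S_comm[OF u walk_vec_carrier, of k 0] k by (simp
        add: v_def walk_k[unfolded walk_vec_0])
    then have sym: "walk_vec 0 \<bullet> v = u \<bullet> walk_vec k"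
      using comm_scalar_prod[OF v walk_vec_carrier[of 0]] by simp
    have "act q \<bullet> (S ^\<^sub>m k *\<^sub>v act q)
        = a * a * (u \<bullet> v) - 2 * a * p0 * (u \<bullet> walk_vec k) + p0 * p0 * walk_count k"
      unfolding Sq unfolding act_q using u v sym
      by (simp add: minus_scalar_prod_distrib[of _ n] scalar_prod_minus_distrib[of _ n]
          walk_count_def algebra_simps)
    moreover have "4 dvd u \<bullet> v" using four[OF k] by (simp add: v_def)
    moreover obtain h where "p0 = 2 * h" using even_p0 by (rule evenE)
    ultimately show ?thesis by (auto intro!: dvd_add dvd_diff)
  qed
  obtain s where s: "subst_neg q = q + Polynomial.smult 2 s" "coeff s 0 = 0"
    using subst_neg_cong_mod_2 by blast
  obtain t where t: "q * q = subst_sq q + Polynomial.smult 2 t"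
    using square_cong_subst_sq_mod_2 by blast
  have t0: "even n \<or> coeff t 0 = 0"
    using q0 arg_cong[OF t, of "\<lambda>p. coeff p 0"]
    by (cases "even n") (simp_all add: coeff_mult poly_0_coeff_0)
  \<comment> \<open>Odd k need no hypothesis on u: only walk counts of odd length occur, and these
    vanish.\<close>
  have four_lin: "4 dvd lin walk_count (monom 1 k * subst_sq q)" for k
  proof (cases "even k")
    case True
    have "subst_neg q * (monom 1 k * q)
        = monom 1 k * subst_sq q + Polynomial.smult 2 (monom 1 k * (t + s * q))"
    proof -
      have "subst_neg q * (monom 1 k * q) = monom 1 k * (q * q)
        + Polynomial.smult 2 (monom 1 k * (s * q))"
        unfolding s by (simp add: algebra_simps)
      then show ?thesis unfolding t by (simp add: algebra_simps smult_add_right)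
    qed
    moreover have "lin walk_count (subst_neg q * (monom 1 k * q)) = act q \<bullet> (S ^\<^sub>m k *\<^sub>v act q)"
      by (simp add: act_scalar_act[symmetric] act_monom_mult)
    moreover have "even (lin walk_count (monom 1 k * (t + s * q)))"
      using t0 s(2) by (intro lin_walk_count_even) (auto simp: coeff_mult)
    ultimately show ?thesis using four_q[OF True] four_dvd_lin_walk_count by metis
  qed (simp add: lin_walk_count_monom_odd)
  obtain g r where "pseudo_divmod q m = (g, r)" by (cases "pseudo_divmod q m")
  then have gr: "q = m * g + r" "r = 0 \<or> degree r < degree m"
  proof -
    assume *: "pseudo_divmod q m = (g, r)"
    have "m \<noteq> 0" using m(2) by auto
    from pseudo_divmod[OF this *] m(2) show "q = m * g + r" "r = 0 \<or> degree r < degree m"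
      by simp_all
  qed
  \<comment> \<open>From deg r < deg m and 2 deg m <= n + 1 the degree of r(x^2) stays below n, so
    its coefficients are coordinates with respect to W.\<close>
  have deg_r: "degree (subst_sq r) < n"
    using gr(2) m(3) n_pos by (auto simp: degree_pcompose degree_monom_eq)
  have act_sq: "act (subst_sq q) = act (subst_sq r)"
  proof -
    have "subst_sq q = \<chi> * (monom 1 (n mod 2) * subst_sq g) + subst_sq r"
      unfolding gr(1) by (simp add: pcompose_add pcompose_mult m(1) ac_simps)
    then show ?thesis by (simp add: act_add act_char_poly_mult)
  qed
  have "vec_dvd 2 (vec n (coeff (subst_sq r)))"
  proof (rule walk_coords_even)
    fix k
    have "walk_vec k \<bullet> (W *\<^sub>v vec n (coeff (subst_sq r))) = act (monom 1 k) \<bullet> act (subst_sq q)"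
      by (simp add: act_monom act_sq act_eq_walk_mult[OF deg_r])
    also have "\<dots> = walk_vec 0 \<bullet> (S ^\<^sub>m k *\<^sub>v act (subst_sq q)) * (-1) ^ k"
      using scalar_pow_S_comm[OF walk_vec_carrier act_carrier, of k 0 "subst_sq q"]
      by (simp add: act_monom walk_vec_def[of k])
    also have "walk_vec 0 \<bullet> (S ^\<^sub>m k *\<^sub>v act (subst_sq q))
      = lin walk_count (monom 1 k * subst_sq q)"
      by (simp add: all_one_scalar_act[symmetric] act_monom_mult)
    finally show "4 dvd walk_vec k \<bullet> (W *\<^sub>v vec n (coeff (subst_sq r)))"
      using four_lin[of k] by simp
  qed simp
  then have even_coeff: "even (coeff (subst_sq r) i)" for i
    using deg_r by (cases "i < n") (auto simp: vec_dvd_def coeff_eq_0)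
  have even_r: "even (coeff r i)" for i
    using even_coeff[of "2 * i"] by (simp add: coeff_subst_sq)
  define r' where "r' = map_poly (\<lambda>x. x div 2) (r + [:p0:])"
  have "r + [:p0:] = Polynomial.smult 2 r'"
  proof (rule poly_eqI)
    fix i
    have "even (coeff (r + [:p0:]) i)" using even_r even_p0 by (cases i) auto
    then show "coeff (r + [:p0:]) i = coeff (Polynomial.smult 2 r') i"
      by (simp add: r'_def coeff_map_poly)
  qed
  moreover have "p = m * g + (r + [:p0:])" using gr(1) by (simp add: q_def)
  ultimately have "a \<cdot>\<^sub>v u = act (m * g + Polynomial.smult 2 r')" using act_p by simp
  with a show ?thesis by (rule that)
qed

text \<open>By self-duality of the standard lattice it suffices to pair \<open>m(S) e\<close> with twice the unit vectors,
  to which the decomposition applies.\<close>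

lemma half_poly_act_even:
  assumes m: "subst_sq m = monom 1 (n mod 2) * \<chi>" "lead_coeff m = 1" "2 * degree m = n + n mod 2"
    "odd n \<Longrightarrow> coeff m 0 = 0"
  shows "vec_dvd 2 (act m)"
  unfolding vec_dvd_def
proof safe
  fix i assume "i < dim_vec (act m)"
  then have i: "i < n" by simp
  define u :: "int vec" where "u = 2 \<cdot>\<^sub>v unit_vec n i"
  have u: "u \<in> carrier_vec n" by (simp add: u_def)
  obtain a g r where a: "odd a" and agr: "a \<cdot>\<^sub>v u = act (m * g + Polynomial.smult 2 r)"
  proof (rule half_poly_decomposition[OF m(1-3) u])
    show "even (walk_vec j \<bullet> u)" for j unfolding u_def by (subst scalar_prod_smult_right) auto
    show "4 dvd u \<bullet> (S ^\<^sub>m k *\<^sub>v u)" for k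
    proof -
      have "S ^\<^sub>m k *\<^sub>v u = 2 \<cdot>\<^sub>v (S ^\<^sub>m k *\<^sub>v unit_vec n i)"
        unfolding u_def by (rule mult_mat_smult_vec[of _ n n]) auto
      then have "u \<bullet> (S ^\<^sub>m k *\<^sub>v u) = 2 * (2 * (unit_vec n i \<bullet> (S ^\<^sub>m k *\<^sub>v unit_vec n i)))"
        unfolding u_def by (simp add: mult_mat_vec_carrier[of _ n n])
      then show ?thesis by simp
    qed
  qed
  obtain s where s: "subst_neg m = m + Polynomial.smult 2 s" "coeff s 0 = 0"
    using subst_neg_cong_mod_2 by blast
  obtain t where t: "m * m = subst_sq m + Polynomial.smult 2 t"
    using square_cong_subst_sq_mod_2 by blast
  have t0: "even n \<or> coeff t 0 = 0"
    using m(4) arg_cong[OF t, of "\<lambda>p. coeff p 0"]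
    by (cases "even n") (simp_all add: coeff_mult poly_0_coeff_0)
  have neg0: "even n \<or> coeff (subst_neg m) 0 = 0" using m(4) s by auto
  \<comment> \<open>The first summand is a multiple of the characteristic polynomial and has value
    0; the polynomial being doubled has even value. So the pairing of m(S) e with a u, which is 2a
    times its i-th entry, vanishes modulo 4.\<close>
  have prod: "subst_neg m * (m * g + Polynomial.smult 2 r)
      = \<chi> * (monom 1 (n mod 2) * g) + Polynomial.smult 2 (t * g + s * m * g + subst_neg m * r)"
  proof -
    have "subst_neg m * (m * g + Polynomial.smult 2 r)
        = (m * m) * g + Polynomial.smult 2 (s * m * g + subst_neg m * r)"
      by (simp add: s algebra_simps smult_add_right)
    then show ?thesis unfolding t m(1) by (simp add: algebra_simps smult_add_right)
  qed
  have "lin walk_count (\<chi> * (monom 1 (n mod 2) * g)) = 0"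
    by (simp add: all_one_scalar_act[symmetric] act_char_poly_mult)
  moreover have "even (lin walk_count (t * g + s * m * g + subst_neg m * r))"
    using t0 s(2) neg0 by (intro lin_walk_count_even) (auto simp: coeff_mult)
  ultimately have "4 dvd lin walk_count (subst_neg m * (m * g + Polynomial.smult 2 r))"
    unfolding prod by (subst four_dvd_lin_walk_count) simp_all
  also have "lin walk_count (subst_neg m * (m * g + Polynomial.smult 2 r)) = a * (2 * act m $ i)"
    using i by (simp add: act_scalar_act[symmetric] agr[symmetric] u_def)
  finally have "2 * 2 dvd 2 * (a * act m $ i)" by (simp add: mult.left_commute)
  then have "2 dvd a * act m $ i" by (simp only: dvd_mult_cancel_left) simp
  then show "2 dvd act m $ i" using a by simp
qed

text \<open>Rigidity at 2 for a single vector: fed with the columns of l Q for an even level l, it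
  makes all of them even, against the minimality of l. In the decomposition the first summand is
  even because m(S) e is.\<close>

theorem walk_two_even:
  assumes u: "u \<in> carrier_vec n"
    and even: "\<And>j. j < n \<Longrightarrow> even (walk_vec j \<bullet> u)"
    and four: "\<And>k. even k \<Longrightarrow> 4 dvd u \<bullet> (S ^\<^sub>m k *\<^sub>v u)"
  shows "vec_dvd 2 u"
proof -
  obtain m where m: "subst_sq m = monom 1 (n mod 2) * \<chi>" "lead_coeff m = 1"
    "2 * degree m = n + n mod 2" "odd n \<Longrightarrow> coeff m 0 = 0"
    using half_char_poly_ex by blast
  obtain a g r where a: "odd a" and agr: "a \<cdot>\<^sub>v u = act (m * g + Polynomial.smult 2 r)"
    using half_poly_decomposition[OF m(1-3) u even four] by blast
  have "vec_dvd 2 (act (m * g) + 2 \<cdot>\<^sub>v act r)"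
    using half_poly_act_even[OF m]
    by (intro vec_dvd_add vec_dvd_act_mult vec_dvd_smult_self) auto
  then have "vec_dvd 2 (a \<cdot>\<^sub>v u)" by (simp add: agr act_add act_smult)
  then show ?thesis using a vec_dvd_smult_cancel[of 2 a u] by simp
qed

end

section \<open>Kernels and isotropic vectors modulo a prime\<close>

lemma det_replace_col_smult:
  fixes A :: "'a :: comm_ring_1 mat"
  assumes A: "A \<in> carrier_mat n n" and b: "b \<in> carrier_vec n" and k: "k < n"
  shows "det (replace_col A (c \<cdot>\<^sub>v b) k) = c * det (replace_col A b k)"
proof -
  have R: "replace_col A v k \<in> carrier_mat n n" for v
    using A by (simp add: replace_col_def)
  have "mat_delete (replace_col A (c \<cdot>\<^sub>v b) k) i k = mat_delete (replace_col A b k) i k" for i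
    by (auto simp: mat_delete_def replace_col_def)
  then have "cofactor (replace_col A (c \<cdot>\<^sub>v b) k) i k = cofactor (replace_col A b k) i k" for i
    by (simp add: cofactor_def)
  then show ?thesis
    unfolding laplace_expansion_column[OF R k] sum_distrib_left
    by (intro sum.cong) (use A b k in \<open>auto simp: replace_col_def\<close>)
qed

lemma prime_sq_dvd_cancel_left:
  fixes p :: int
  assumes "prime p" "\<not> p dvd a" "p * p dvd a * b"
  shows "p * p dvd b"
  using assms by (metis coprime_dvd_mult_right_iff coprime_mult_left_iff prime_imp_coprime)

text \<open>If \<open>p\<close> divides \<open>det A\<close> only once, the kernel of \<open>A\<close> modulo \<open>p\<close> is at most a line:
  replacing a column by \<open>A x / p\<close> produces a matrix that is invertible modulo \<open>p\<close>.\<close>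

lemma kernel_mod_prime_proportional:
  assumes p: "prime p" and A: "A \<in> carrier_mat n n" and nsq: "\<not> p * p dvd det A"
    and x: "x \<in> carrier_vec n" "vec_dvd p (A *\<^sub>v x)"
    and y: "y \<in> carrier_vec n" "vec_dvd p (A *\<^sub>v y)"
    and i: "i < n"
  shows "vec_dvd p (x $ i \<cdot>\<^sub>v y - y $ i \<cdot>\<^sub>v x)"
proof -
  \<comment> \<open>The roles of x and y are symmetric, and nothing is to be shown if p divides both
    i-th coordinates; so p may be assumed not to divide that of x.\<close>
  have main: "vec_dvd p (x $ i \<cdot>\<^sub>v y - y $ i \<cdot>\<^sub>v x)"
    if x: "x \<in> carrier_vec n" "vec_dvd p (A *\<^sub>v x)"
      and y: "y \<in> carrier_vec n" "vec_dvd p (A *\<^sub>v y)" and xi: "\<not> p dvd x $ i" for x y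
  proof -
    have Ax: "A *\<^sub>v x \<in> carrier_vec n"
      using A x by (auto intro!: mult_mat_vec_carrier)
    obtain b where b: "b \<in> carrier_vec n" "A *\<^sub>v x = p \<cdot>\<^sub>v b" using vec_dvdE[OF x(2) Ax] .
    define R where "R = replace_col A b i"
    have R: "R \<in> carrier_mat n n" using A by (simp add: R_def replace_col_def)
    have det: "x $ i * det A = p * det R"
      using cramer_lemma_mat[OF A x(1) i] unfolding b(2) det_replace_col_smult[OF A b(1) i] R_def
      by simp
    have nR: "\<not> p dvd det R"
    proof
      assume "p dvd det R"
      then have "p * p dvd x $ i * det A" unfolding det by simp
      then show False using prime_sq_dvd_cancel_left[OF p xi, of "det A"] nsq by simp
    qed
    define v where "v = x $ i \<cdot>\<^sub>v y - y $ i \<cdot>\<^sub>v x"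
    have v: "v \<in> carrier_vec n" using x y by (simp add: v_def)
    \<comment> \<open>As its i-th coordinate vanishes, v does not see the replaced column, and R v =
      A v.\<close>
    have vi: "v $ i = 0" using x y i by (simp add: v_def mult.commute)
    have "R *\<^sub>v v = A *\<^sub>v v"
    proof (rule eq_vecI)
      fix r assume "r < dim_vec (A *\<^sub>v v)"
      then show "(R *\<^sub>v v) $ r = (A *\<^sub>v v) $ r"
        using A v vi by (auto simp: R_def replace_col_def scalar_prod_def intro!: sum.cong)
    qed (use A in \<open>simp add: R_def replace_col_def\<close>)
    also have "A *\<^sub>v v = x $ i \<cdot>\<^sub>v (A *\<^sub>v y) - y $ i \<cdot>\<^sub>v (A *\<^sub>v x)"
      unfolding v_def using A x y
      by (simp add: mult_minus_distrib_mat_vec[of _ n n] mult_mat_smult_vec[of _ n n])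
    finally have "vec_dvd p (R *\<^sub>v v)"
      using x(2) y(2) A by (auto simp: vec_dvd_def)
    then have "vec_dvd p (det R \<cdot>\<^sub>v v)"
      unfolding adj_mat_mult_mult(1)[OF R v, symmetric] by (rule vec_dvd_mult_mat)
    then show ?thesis unfolding v_def
      by (rule vec_dvd_smult_cancel[rotated]) (use p nR in \<open>simp add: prime_imp_coprime\<close>)
  qed
  consider "\<not> p dvd x $ i" | "\<not> p dvd y $ i" | "p dvd x $ i" "p dvd y $ i" by blast
  then show ?thesis
  proof cases
    case 1
    then show ?thesis using main x y by blast
  next
    case 2
    then have "vec_dvd p (y $ i \<cdot>\<^sub>v x - x $ i \<cdot>\<^sub>v y)" using main x y by blast
    then show ?thesis using x y by (auto simp: vec_dvd_def dvd_diff_commute)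
  next
    case 3
    then show ?thesis using x y by (auto simp: vec_dvd_def)
  qed
qed

lemma smult_eq_scalar_prod:
  fixes x :: "int vec"
  assumes "a \<cdot>\<^sub>v v = c \<cdot>\<^sub>v x + p \<cdot>\<^sub>v w"
    and "u \<in> carrier_vec n" "v \<in> carrier_vec n" "x \<in> carrier_vec n" "w \<in> carrier_vec n"
  shows "a * (u \<bullet> v) = c * (u \<bullet> x) + p * (u \<bullet> w)"
proof -
  have "a * (u \<bullet> v) = u \<bullet> (a \<cdot>\<^sub>v v)" using assms(2-) by simp
  also have "\<dots> = c * (u \<bullet> x) + p * (u \<bullet> w)"
    unfolding assms(1) using assms(2-) by (simp add: scalar_prod_add_distrib[of _ n])
  finally show ?thesis .
qed

text \<open>The hyperbolic plane over the field with \<open>p\<close> elements has just two isotropic lines;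
  here \<open>x0, x\<close> and \<open>y0, y\<close> both represent the one that is not the standard lattice.\<close>

lemma isotropic_line_unique:
  fixes p :: int
  assumes p: "prime p" "odd p"
    and carrier: "x0 \<in> carrier_vec n" "x \<in> carrier_vec n" "y0 \<in> carrier_vec n" "y \<in> carrier_vec n"
    and i: "i < n" "\<not> p dvd x0 $ i"
    and proportional: "\<And>v. v \<in> {x, y0, y} \<Longrightarrow> vec_dvd p (x0 $ i \<cdot>\<^sub>v v - v $ i \<cdot>\<^sub>v x0)"
    and ny0: "\<not> vec_dvd p y0"
    and iso: "p * p dvd x0 \<bullet> x0" "p * p dvd x0 \<bullet> x" "p * p dvd y \<bullet> y" "p * p dvd y0 \<bullet> y"
  shows "p * p dvd x \<bullet> y"
proof -
  define s where "s = x0 $ i"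
  have cop: "coprime p a" if "\<not> p dvd a" for a using p that by (simp add: prime_imp_coprime)
  have p0: "p \<noteq> 0" using p by auto
  \<comment> \<open>Modulo p every vector in play is a multiple of x0. The factor s avoids inverting
    x0_i modulo p.\<close>
  have dec: "\<exists>w. w \<in> carrier_vec n \<and> s \<cdot>\<^sub>v v = v $ i \<cdot>\<^sub>v x0 + p \<cdot>\<^sub>v w"
    if v: "v \<in> {x, y0, y}" for v
  proof -
    have vc: "v \<in> carrier_vec n" using v carrier by auto
    have "s \<cdot>\<^sub>v v - v $ i \<cdot>\<^sub>v x0 \<in> carrier_vec n" using vc carrier by auto
    then obtain w where w: "w \<in> carrier_vec n" "s \<cdot>\<^sub>v v - v $ i \<cdot>\<^sub>v x0 = p \<cdot>\<^sub>v w"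
      using vec_dvdE proportional[OF v] unfolding s_def by blast
    have "s \<cdot>\<^sub>v v = v $ i \<cdot>\<^sub>v x0 + (s \<cdot>\<^sub>v v - v $ i \<cdot>\<^sub>v x0)"
      by (rule eq_vecI) (use vc carrier in auto)
    then show ?thesis using w by auto
  qed
  obtain w where w: "w \<in> carrier_vec n" "s \<cdot>\<^sub>v x = x $ i \<cdot>\<^sub>v x0 + p \<cdot>\<^sub>v w" using dec[of x] by auto
  obtain w0 where w0: "w0 \<in> carrier_vec n" "s \<cdot>\<^sub>v y0 = y0 $ i \<cdot>\<^sub>v x0 + p \<cdot>\<^sub>v w0"
    using dec[of y0] by auto
  obtain w' where w': "w' \<in> carrier_vec n" "s \<cdot>\<^sub>v y = y $ i \<cdot>\<^sub>v x0 + p \<cdot>\<^sub>v w'" using dec[of y]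
    by auto
  have comm: "u \<bullet> v = v \<bullet> u" if "u \<in> carrier_vec n" "v \<in> carrier_vec n" for u v :: "int vec"
    using comm_scalar_prod[OF that] .
  note expand = smult_eq_scalar_prod[where n = n]
  have x0y: "s * (x0 \<bullet> y) = y $ i * (x0 \<bullet> x0) + p * (x0 \<bullet> w')"
    by (rule expand[OF w'(2)]) (use carrier w' in auto)
  have x0x: "s * (x0 \<bullet> x) = x $ i * (x0 \<bullet> x0) + p * (x0 \<bullet> w)"
    by (rule expand[OF w(2)]) (use carrier w in auto)
  have p_dvd: "p dvd b" if "p * p dvd a + p * b" "p * p dvd a" for a b
  proof -
    have "p * p dvd p * b" using that by (simp add: dvd_add_right_iff)
    then show ?thesis using p0 by simp
  qed
  have x0w: "p dvd x0 \<bullet> w"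
    using p_dvd[of "x $ i * (x0 \<bullet> x0)"] iso(1,2) x0x by (metis dvd_mult)
  \<comment> \<open>If p does not divide y_i, the isotropy of y gives p | 2 y_i (x0.w'), and p is
    odd. Otherwise y is zero modulo p and carries no direction; its pairing with y0, which is
    nonzero modulo p, takes over.\<close>
  have x0w': "p dvd x0 \<bullet> w'"
  proof (cases "p dvd y $ i")
    case False
    have 1: "s * (y \<bullet> y) = y $ i * (y \<bullet> x0) + p * (y \<bullet> w')"
      by (rule expand[OF w'(2)]) (use carrier w' in auto)
    have 2: "s * (w' \<bullet> y) = y $ i * (w' \<bullet> x0) + p * (w' \<bullet> w')"
      by (rule expand[OF w'(2)]) (use carrier w' in auto)
    have "s * (s * (y \<bullet> y)) = y $ i * (s * (x0 \<bullet> y)) + p * (s * (w' \<bullet> y))"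
      unfolding 1 using comm[OF carrier(1,4)] comm[OF w'(1) carrier(4)] by (simp add: algebra_simps)
    also have "\<dots> = (y $ i * y $ i * (x0 \<bullet> x0) + p * p * (w' \<bullet> w')) + p * (2 * (y $ i * (x0 \<bullet> w')))"
      unfolding x0y 2 using comm[OF carrier(1) w'(1)] by (simp add: algebra_simps)
    finally have "p * p dvd (y $ i * y $ i * (x0 \<bullet> x0) + p * p * (w' \<bullet> w'))
        + p * (2 * (y $ i * (x0 \<bullet> w')))"
      using iso(3) by (metis dvd_mult)
    then have "p dvd 2 * (y $ i * (x0 \<bullet> w'))"
      by (rule p_dvd) (use iso(1) in auto)
    moreover have "\<not> p dvd 2"
    proof
      assume "p dvd 2"
      then have "p = 2" using prime_ge_2_int[OF p(1)] zdvd_imp_le[of p 2] by simp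
      with p(2) show False by simp
    qed
    ultimately show ?thesis using False p by (auto simp: prime_dvd_mult_iff)
  next
    case True
    have y0i: "\<not> p dvd y0 $ i"
    proof
      assume "p dvd y0 $ i"
      then have "vec_dvd p (s \<cdot>\<^sub>v y0)" unfolding w0(2) using carrier w0 by (auto simp: vec_dvd_def)
      then show False using vec_dvd_smult_cancel[OF cop, of s y0] i ny0 by (simp add: s_def)
    qed
    have 1: "s * (y \<bullet> y0) = y0 $ i * (y \<bullet> x0) + p * (y \<bullet> w0)"
      by (rule expand[OF w0(2)]) (use carrier w0 in auto)
    have 2: "s * (w0 \<bullet> y) = y $ i * (w0 \<bullet> x0) + p * (w0 \<bullet> w')"
      by (rule expand[OF w'(2)]) (use carrier w0 w' in auto)
    have "s * (s * (y \<bullet> y0)) = y0 $ i * (s * (x0 \<bullet> y)) + p * (s * (w0 \<bullet> y))"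
      unfolding 1 using comm[OF carrier(1,4)] comm[OF w0(1) carrier(4)] by (simp add: algebra_simps)
    also have "\<dots> = (y0 $ i * y $ i * (x0 \<bullet> x0) + p * (y $ i * (w0 \<bullet> x0)) + p * p * (w0 \<bullet> w'))
        + p * (y0 $ i * (x0 \<bullet> w'))"
      unfolding x0y 2 by (simp add: algebra_simps)
    finally have "p * p dvd (y0 $ i * y $ i * (x0 \<bullet> x0) + p * (y $ i * (w0 \<bullet> x0)) + p * p * (w0
      \<bullet> w'))
        + p * (y0 $ i * (x0 \<bullet> w'))"
      using iso(4) comm[OF carrier(3,4)] by (metis dvd_mult)
    then have "p dvd y0 $ i * (x0 \<bullet> w')"
      by (rule p_dvd) (use iso(1) True in \<open>auto intro!: dvd_add mult_dvd_mono\<close>)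
    then show ?thesis using y0i p by (auto simp: prime_dvd_mult_iff)
  qed
  have 1: "s * (y \<bullet> x) = x $ i * (y \<bullet> x0) + p * (y \<bullet> w)"
    by (rule expand[OF w(2)]) (use carrier w in auto)
  have 2: "s * (w \<bullet> y) = y $ i * (w \<bullet> x0) + p * (w \<bullet> w')"
    by (rule expand[OF w'(2)]) (use carrier w w' in auto)
  have "s * (s * (x \<bullet> y)) = x $ i * (s * (x0 \<bullet> y)) + p * (s * (w \<bullet> y))"
    using 1 comm[OF carrier(1,4)] comm[OF w(1) carrier(4)] comm[OF carrier(2,4)]
    by (simp add: algebra_simps)
  also have "\<dots> = x $ i * y $ i * (x0 \<bullet> x0) + p * (x $ i * (x0 \<bullet> w'))
      + p * (y $ i * (x0 \<bullet> w)) + p * p * (w \<bullet> w')"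
    unfolding x0y 2 using comm[OF carrier(1) w(1)] by (simp add: algebra_simps)
  finally have "p * p dvd s * (s * (x \<bullet> y))"
    using iso(1) x0w x0w' by (auto intro!: dvd_add mult_dvd_mono)
  moreover have "\<not> p dvd s" using i by (simp add: s_def)
  ultimately show ?thesis
    using prime_sq_dvd_cancel_left[OF p(1)] by blast
qed

section \<open>Odd primes\<close>

lemma smult_vec_cancel:
  fixes x y :: "'a :: idom vec"
  assumes eq: "c \<cdot>\<^sub>v x = c \<cdot>\<^sub>v y" and c: "c \<noteq> 0"
  shows "x = y"
proof (rule eq_vecI)
  show dim: "dim_vec x = dim_vec y" using arg_cong[OF eq, of dim_vec] by simp
  show "x $ i = y $ i" if "i < dim_vec y" for i
    using arg_cong[OF eq, of "\<lambda>v. v $ i"] c that dim by simp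
qed

locale walk_prime = skew_int_mat +
  fixes p :: int
  assumes p_prime: "prime p" and p_simple: "\<not> p * p dvd det W"
begin

lemma coprime_p: "\<not> p dvd a \<Longrightarrow> coprime p a"
  using p_prime by (rule prime_imp_coprime)

lemma p_nz: "p \<noteq> 0"
  using p_prime by auto

text \<open>The kernel of \<open>W\<^sup>T\<close> modulo p: the vectors z for which z / p has
  integral scalar product with the columns of W.\<close>

definition null :: "int vec \<Rightarrow> bool" where
  "null z \<longleftrightarrow> z \<in> carrier_vec n \<and> vec_dvd p (transpose_mat W *\<^sub>v z)"

lemma null_iff: "null z \<longleftrightarrow> z \<in> carrier_vec n \<and> (\<forall>j<n. p dvd walk_vec j \<bullet> z)"
  by (simp add: null_def vec_dvd_def col_W)

lemma null_proportional:
  "null x \<Longrightarrow> null y \<Longrightarrow> i < n \<Longrightarrow> vec_dvd p (x $ i \<cdot>\<^sub>v y - y $ i \<cdot>\<^sub>v x)"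
  unfolding null_def
  by (rule kernel_mod_prime_proportional[OF p_prime, of "transpose_mat W"])
    (use p_simple in \<open>simp_all add: det_transpose[of _ n]\<close>)

lemma p_dvd_det:
  assumes z: "null z" "\<not> vec_dvd p z"
  obtains a where "det W = p * a" "\<not> p dvd a"
proof -
  have "vec_dvd p (det W \<cdot>\<^sub>v z)"
    using adj_mat_mult_mult(1)[of "transpose_mat W" n z] z(1)
      vec_dvd_mult_mat[of p "transpose_mat W *\<^sub>v z" "adj_mat (transpose_mat W)"]
    by (auto simp: null_def det_transpose[of _ n])
  then have "p dvd det W"
    using z(2) coprime_p vec_dvd_smult_cancel by blast
  then show ?thesis using that p_simple by (auto elim!: dvdE)
qed

text \<open>The rows of adj W are null vectors, since adj W * W = det W * I, hence proportional to z
  modulo p. So p divides (adj W) x when it divides z.x, and W (adj W) x = p a x can be divided by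
  p.\<close>

lemma walk_coords_of_orthogonal:
  assumes z: "null z" "\<not> vec_dvd p z" and x: "x \<in> carrier_vec n" and zx: "p dvd z \<bullet> x"
    and d: "det W = p * a"
  obtains f where "f \<in> carrier_vec n" "a \<cdot>\<^sub>v x = W *\<^sub>v f"
proof -
  have zc: "z \<in> carrier_vec n" using z(1) by (simp add: null_def)
  obtain i where i: "i < n" "\<not> p dvd z $ i" using z(2) zc by (auto simp: vec_dvd_def)
  note adj = adj_mat[OF W_carrier]
  have "vec_dvd p (adj_mat W *\<^sub>v x)"
    unfolding vec_dvd_def
  proof safe
    fix k assume "k < dim_vec (adj_mat W *\<^sub>v x)"
    then have k: "k < n" using adj(1) by simp
    define r where "r = row (adj_mat W) k"
    have r: "r \<in> carrier_vec n" using adj(1) row_carrier[of "adj_mat W" k] by (simp add: r_def)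
    have "walk_vec j \<bullet> r = (adj_mat W * W) $$ (k,j)" if "j < n" for j
      using that k adj(1) r comm_scalar_prod[OF r walk_vec_carrier] by (simp add: r_def col_W)
    then have "null r" using r k by (auto simp: null_iff adj(3) d)
    from null_proportional[OF z(1) this i(1)]
    have "p dvd x \<bullet> (z $ i \<cdot>\<^sub>v r - r $ i \<cdot>\<^sub>v z)" by (rule vec_dvd_scalar_prod)
    also have "x \<bullet> (z $ i \<cdot>\<^sub>v r - r $ i \<cdot>\<^sub>v z) = z $ i * (x \<bullet> r) - r $ i * (x \<bullet> z)"
      using x r zc by (simp add: scalar_prod_minus_distrib[of _ n])
    finally have "p dvd z $ i * (x \<bullet> r)"
      using zx comm_scalar_prod[OF x zc] by (simp add: dvd_diff_left_iff)
    then have "p dvd r \<bullet> x"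
      using i coprime_p comm_scalar_prod[OF x r] by (simp add: coprime_dvd_mult_right_iff)
    then show "p dvd (adj_mat W *\<^sub>v x) $ k" using k adj(1) by (simp add: r_def)
  qed
  moreover have "adj_mat W *\<^sub>v x \<in> carrier_vec n" using adj(1) x by (rule mult_mat_vec_carrier)
  ultimately obtain f where f: "f \<in> carrier_vec n" "adj_mat W *\<^sub>v x = p \<cdot>\<^sub>v f"
    by (rule vec_dvdE)
  have "p \<cdot>\<^sub>v (a \<cdot>\<^sub>v x) = p \<cdot>\<^sub>v (W *\<^sub>v f)"
    using adj_mat_mult_mult(2)[OF W_carrier x] f
    by (simp add: d smult_smult_assoc mult_mat_smult_vec[of _ n n])
  then have "a \<cdot>\<^sub>v x = W *\<^sub>v f" using p_nz by (rule smult_vec_cancel)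
  with f(1) show ?thesis by (rule that)
qed

text \<open>Multiplication by x on coefficient vectors, with the top coefficient dropped; that
  coefficient is accounted for separately by \<open>walk_vec n\<close>.\<close>

definition shift_vec :: "int vec \<Rightarrow> int vec" where
  "shift_vec f = vec n (\<lambda>j. if j = 0 then 0 else f $ (j - 1))"

lemma shift_vec_carrier [simp]: "shift_vec f \<in> carrier_vec n"
  by (simp add: shift_vec_def)

lemma S_mult_walk:
  assumes f: "f \<in> carrier_vec n" and n: "0 < n"
  shows "S *\<^sub>v (W *\<^sub>v f) = W *\<^sub>v shift_vec f + f $ (n - 1) \<cdot>\<^sub>v walk_vec n"
proof (rule eq_vecI)
  fix r assume "r < dim_vec (W *\<^sub>v shift_vec f + f $ (n - 1) \<cdot>\<^sub>v walk_vec n)"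
  then have r: "r < n" by simp
  have "(S *\<^sub>v (W *\<^sub>v f)) $ r = ((S * W) *\<^sub>v f) $ r"
    using f by (simp add: assoc_mult_mat_vec[of _ n n _ n])
  also have "\<dots> = (\<Sum>j\<in>{0..<n}. walk_vec (Suc j) $ r * f $ j)"
  proof -
    have "(S * W) $$ (r,j) = walk_vec (Suc j) $ r" if "j < n" for j
      using that r by (simp add: walk_vec_Suc col_W)
    then show ?thesis using r f by (simp add: scalar_prod_def)
  qed
  also have "{0..<n} = insert (n - 1) {0..<n - 1}" using n by auto
  also have "(\<Sum>j\<in>insert (n - 1) {0..<n - 1}. walk_vec (Suc j) $ r * f $ j)
      = walk_vec n $ r * f $ (n - 1) + (\<Sum>j\<in>{0..<n - 1}. walk_vec (Suc j) $ r * f $ j)"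
    using n by simp
  also have "(\<Sum>j\<in>{0..<n - 1}. walk_vec (Suc j) $ r * f $ j)
    = (\<Sum>j\<in>{Suc 0..<n}. walk_vec j $ r * f $ (j - 1))"
    using n sum.shift_bounds_Suc_ivl[of "\<lambda>j. walk_vec j $ r * f $ (j - 1)" 0 "n - 1"] by simp
  also have "\<dots> = (W *\<^sub>v shift_vec f) $ r"
  proof -
    have "(W *\<^sub>v shift_vec f) $ r = (\<Sum>j\<in>{0..<n}. walk_vec j $ r * shift_vec f $ j)"
      using r by (simp add: scalar_prod_def index_W shift_vec_def)
    also have "\<dots> = (\<Sum>j\<in>{Suc 0..<n}. walk_vec j $ r * shift_vec f $ j)"
      using n by (subst sum.atLeast_Suc_lessThan) (auto simp: shift_vec_def)
    finally show ?thesis by (simp add: shift_vec_def)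
  qed
  finally show "(S *\<^sub>v (W *\<^sub>v f)) $ r = (W *\<^sub>v shift_vec f + f $ (n - 1) \<cdot>\<^sub>v walk_vec n) $ r"
    using r by simp
qed simp

text \<open>The walk vectors span a cyclic module, so a relation between them modulo \<open>p\<close>
  that avoids the last one could be shifted, giving a second independent relation.\<close>

lemma walk_kernel_last:
  assumes f: "f \<in> carrier_vec n" "vec_dvd p (W *\<^sub>v f)" "\<not> vec_dvd p f"
  shows "\<not> p dvd f $ (n - 1)"
proof
  assume last: "p dvd f $ (n - 1)"
  obtain i0 where i0: "i0 < n" "\<not> p dvd f $ i0" using f by (auto simp: vec_dvd_def)
  define i where "i = Max {i. i < n \<and> \<not> p dvd f $ i}"
  have "i \<in> {i. i < n \<and> \<not> p dvd f $ i}"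
    unfolding i_def by (rule Max_in) (use i0 in auto)
  then have i: "i < n" "\<not> p dvd f $ i" by auto
  have max: "p dvd f $ j" if "i < j" "j < n" for j
    using Max_ge[of "{i. i < n \<and> \<not> p dvd f $ i}" j] that unfolding i_def[symmetric] by fastforce
  have "i \<noteq> n - 1" using last i by auto
  then have Suc_i: "Suc i < n" using i by simp
  have "W *\<^sub>v shift_vec f = S *\<^sub>v (W *\<^sub>v f) - f $ (n - 1) \<cdot>\<^sub>v walk_vec n"
    using S_mult_walk[OF f(1)] i by auto
  then have "vec_dvd p (W *\<^sub>v shift_vec f)"
    using vec_dvd_mult_mat[OF f(2), of S] last by (auto simp: vec_dvd_def)
  then have "vec_dvd p (f $ i \<cdot>\<^sub>v shift_vec f - shift_vec f $ i \<cdot>\<^sub>v f)"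
    using kernel_mod_prime_proportional[OF p_prime W_carrier p_simple f(1,2) shift_vec_carrier _ i(1)]
    by blast
  \<comment> \<open>This is coordinate i + 1 of the proportionality, where the shifted vector has
    the entry f_i.\<close>
  then have "p dvd f $ i * f $ i - shift_vec f $ i * f $ Suc i"
    using Suc_i f(1) by (auto simp: vec_dvd_def shift_vec_def)
  moreover have "p dvd f $ Suc i" using max Suc_i by simp
  ultimately have "p dvd f $ i * f $ i" by (metis dvd_diff_left_iff dvd_mult)
  then show False using i(2) p_prime by (simp add: prime_dvd_mult_iff)
qed

text \<open>Correcting by the relation with unit last coefficient, the null vector becomes \<open>x = W h\<close> with
  last coefficient of \<open>h\<close> zero, so \<open>S x
    = p y\<close> is \<open>W\<close> applied to the shift of \<open>h\<close>. By skewness \<open>y\<close> is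
  orthogonal to \<open>x\<close>, hence a \<open>p\<close>-integral combination of the walk vectors, which forces \<open>p\<close> to divide \<open>h\<close>.\<close>

lemma isotropic_null_not_killed:
  assumes z: "null z" "\<not> vec_dvd p z" and iso: "p dvd z \<bullet> z" and killed: "vec_dvd p (S *\<^sub>v z)"
  shows False
proof -
  have zc: "z \<in> carrier_vec n" using z(1) by (simp add: null_def)
  obtain i where i: "i < n" "\<not> p dvd z $ i" using z(2) zc by (auto simp: vec_dvd_def)
  obtain a where a: "det W = p * a" "\<not> p dvd a" using p_dvd_det[OF z] .
  obtain c where c: "c \<in> carrier_vec n" "a \<cdot>\<^sub>v z = W *\<^sub>v c"
    using walk_coords_of_orthogonal[OF z zc iso a(1)] .
  \<comment> \<open>The i-th column of adj W is the relation sought: W f = det W e_i is zero modulo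
    p. Were f itself divisible by p, W would take f / p to a e_i, whose pairing a z_i with the null
    vector z is not divisible by p.\<close>
  define f where "f = adj_mat W *\<^sub>v unit_vec n i"
  have f: "f \<in> carrier_vec n"
    unfolding f_def using adj_mat(1)[OF W_carrier] by (rule mult_mat_vec_carrier) simp
  have Wf: "W *\<^sub>v f = det W \<cdot>\<^sub>v unit_vec n i"
    unfolding f_def by (rule adj_mat_mult_mult(2)[OF W_carrier]) simp
  have Wf_dvd: "vec_dvd p (W *\<^sub>v f)" unfolding Wf a(1) by (simp add: vec_dvd_def)
  have "\<not> vec_dvd p f"
  proof
    assume "vec_dvd p f"
    then obtain f1 where f1: "f1 \<in> carrier_vec n" "f = p \<cdot>\<^sub>v f1" using f by (rule vec_dvdE)
    have "p \<cdot>\<^sub>v (W *\<^sub>v f1) = p \<cdot>\<^sub>v (a \<cdot>\<^sub>v unit_vec n i)"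
      using Wf f1 by (simp add: a smult_smult_assoc mult_mat_smult_vec[of _ n n])
    then have "W *\<^sub>v f1 = a \<cdot>\<^sub>v unit_vec n i" using p_nz by (rule smult_vec_cancel)
    then have "(transpose_mat W *\<^sub>v z) \<bullet> f1 = a * z $ i"
      using transpose_vec_mult_scalar[OF W_carrier f1(1) zc] zc i by simp
    moreover have "p dvd f1 \<bullet> (transpose_mat W *\<^sub>v z)"
      using z(1) by (intro vec_dvd_scalar_prod) (simp add: null_def)
    ultimately have "p dvd a * z $ i"
      using comm_scalar_prod[OF f1(1), of "transpose_mat W *\<^sub>v z"] zc
      by (simp add: mult_mat_vec_carrier[of _ n n])
    then show False using a(2) i(2) p_prime by (simp add: prime_dvd_mult_iff)
  qed
  with f Wf_dvd have last: "\<not> p dvd f $ (n - 1)" by (rule walk_kernel_last)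
  define h where "h = f $ (n - 1) \<cdot>\<^sub>v c - c $ (n - 1) \<cdot>\<^sub>v f"
  have h: "h \<in> carrier_vec n" using f c by (simp add: h_def)
  have h_last: "h $ (n - 1) = 0" using f c i by (simp add: h_def)
  define x where "x = W *\<^sub>v h"
  have x: "x \<in> carrier_vec n" unfolding x_def using h by (rule mult_mat_vec_carrier[OF W_carrier])
  have x_eq: "x = (f $ (n - 1) * a) \<cdot>\<^sub>v z - c $ (n - 1) \<cdot>\<^sub>v (W *\<^sub>v f)"
    unfolding x_def h_def using f c
    by (simp add: mult_minus_distrib_mat_vec[of _ n n] mult_mat_smult_vec[of _ n n]
        c(2)[symmetric] smult_smult_assoc)
  have x_mod: "vec_dvd p (A *\<^sub>v x)" if A: "A \<in> carrier_mat n n" and "vec_dvd p (A *\<^sub>v z)" for A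
  proof -
    have WfA: "W *\<^sub>v f \<in> carrier_vec n" using f by (rule mult_mat_vec_carrier[OF W_carrier])
    have "A *\<^sub>v x = (f $ (n - 1) * a) \<cdot>\<^sub>v (A *\<^sub>v z) - c $ (n - 1) \<cdot>\<^sub>v (A *\<^sub>v (W *\<^sub>v f))"
      unfolding x_eq using A zc WfA
      by (simp add: mult_minus_distrib_mat_vec[of _ n n] mult_mat_smult_vec[of _ n n])
    then show ?thesis
      using that vec_dvd_mult_mat[OF Wf_dvd, of A] A by (auto simp: vec_dvd_def)
  qed
  have x_null: "null x" using x_mod[of "transpose_mat W"] z(1) x by (simp add: null_def)
  have x_nz: "\<not> vec_dvd p x"
  proof
    assume xd: "vec_dvd p x"
    have "p dvd x $ i" "p dvd (W *\<^sub>v f) $ i" using xd Wf_dvd i x by (auto simp: vec_dvd_def)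
    moreover have "f $ (n - 1) * a * z $ i = x $ i + c $ (n - 1) * (W *\<^sub>v f) $ i"
      unfolding x_eq using i zc by (simp del: index_mult_mat_vec)
    ultimately have "p dvd f $ (n - 1) * a * z $ i" by simp
    then show False using last a(2) i(2) p_prime by (simp add: prime_dvd_mult_iff)
  qed
  have Sx_dvd: "vec_dvd p (S *\<^sub>v x)" by (rule x_mod[OF S_carrier killed])
  have Sx: "S *\<^sub>v x \<in> carrier_vec n" using x by (rule mult_mat_vec_carrier[OF S_carrier])
  obtain y where y: "y \<in> carrier_vec n" "S *\<^sub>v x = p \<cdot>\<^sub>v y" using vec_dvdE[OF Sx_dvd Sx] .
  have "p * (x \<bullet> y) = 0" using skew_isotropic[OF x] x y by simp
  then have "p dvd x \<bullet> y" using p_nz by simp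
  then obtain f' where f': "f' \<in> carrier_vec n" "a \<cdot>\<^sub>v y = W *\<^sub>v f'"
    using walk_coords_of_orthogonal[OF x_null x_nz y(1) _ a(1)] by blast
  have "S *\<^sub>v x = W *\<^sub>v shift_vec h"
    unfolding x_def S_mult_walk[OF h order.strict_trans1[OF le0 i(1)]] h_last by auto
  then have "W *\<^sub>v (a \<cdot>\<^sub>v shift_vec h) = a \<cdot>\<^sub>v (p \<cdot>\<^sub>v y)"
    by (simp add: mult_mat_smult_vec[of _ n n] y(2))
  also have "\<dots> = W *\<^sub>v (p \<cdot>\<^sub>v f')"
    using f' by (simp add: mult_mat_smult_vec[of _ n n] f'(2)[symmetric] smult_smult_assoc mult.commute)
  finally have "a \<cdot>\<^sub>v shift_vec h = p \<cdot>\<^sub>v f'"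
    by (rule mult_mat_vec_cancel[OF W_carrier, rotated 3]) (use f' p_simple in auto)
  then have "vec_dvd p (a \<cdot>\<^sub>v shift_vec h)" by (simp add: vec_dvd_smult_self)
  then have sh: "vec_dvd p (shift_vec h)" by (rule vec_dvd_smult_cancel[OF coprime_p[OF a(2)]])
  \<comment> \<open>The shift loses only the last coordinate, which is zero in h.\<close>
  have "vec_dvd p h"
    unfolding vec_dvd_def
  proof safe
    fix j assume "j < dim_vec h"
    then have j: "j < n" using h by simp
    show "p dvd h $ j"
    proof (cases "Suc j < n")
      case True
      then show ?thesis using sh by (auto simp: vec_dvd_def shift_vec_def)
    next
      case False
      then have "j = n - 1" using j by simp
      then show ?thesis using h_last by simp
    qed
  qed
  then have "vec_dvd p x" unfolding x_def by (rule vec_dvd_mult_mat)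
  with x_nz show False ..
qed

end

lemma walk_vec_uminus:
  assumes "square_int_mat n S"
  shows "square_int_mat.walk_vec n (- S) k = (-1) ^ k \<cdot>\<^sub>v square_int_mat.walk_vec n S k"
proof -
  interpret S: square_int_mat n S by fact
  interpret N: square_int_mat n "- S" by unfold_locales simp
  show ?thesis
  proof (induction k)
    case 0
    then show ?case by simp
  next
    case (Suc k)
    have "N.walk_vec (Suc k) = - (S *\<^sub>v ((-1) ^ k \<cdot>\<^sub>v S.walk_vec k))"
      by (simp add: N.walk_vec_Suc Suc)
    also have "\<dots> = (-1) ^ Suc k \<cdot>\<^sub>v S.walk_vec (Suc k)"
      by (auto simp: S.walk_vec_Suc mult_mat_smult_vec[of _ n n])
    finally show ?case .
  qed
qed

locale walk_prime_conj = walk_prime n S p + scaled_conj n S T M l for n S p T M l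
begin

lemma null_col:
  assumes "p dvd l" "x \<in> carrier_vec n"
  shows "null (M *\<^sub>v x)"
  using assms by (simp add: null_iff walk_vec_scalar_col)

text \<open>A conjugation to the converse that is invertible modulo \<open>p\<close> preserves the null line
  and anticommutes with \<open>S\<close>, so the eigenvalue of \<open>S\<close> on that line is zero.\<close>

lemma converse_conj_kills_null:
  assumes T: "T = - S" and l: "\<not> p dvd l" and p: "odd p"
    and z: "null z" "null (S *\<^sub>v z)" "\<not> vec_dvd p z"
  shows "vec_dvd p (S *\<^sub>v z)"
proof -
  have zc: "z \<in> carrier_vec n" using z(1) by (simp add: null_def)
  obtain i where i: "i < n" "\<not> p dvd z $ i" using z(3) zc by (auto simp: vec_dvd_def)
  define y where "y = M *\<^sub>v z"
  define q where "q = S *\<^sub>v z"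
  have y: "y \<in> carrier_vec n" and q: "q \<in> carrier_vec n"
    using zc by (auto simp: y_def q_def intro!: mult_mat_vec_carrier[OF S_carrier])
  have "null y"
    unfolding null_iff y_def using z(1) walk_vec_uminus[OF square_int_mat_axioms]
    by (auto simp: walk_vec_scalar_col[OF zc] T null_iff)
  define s where "s = z $ i"
  have 1: "vec_dvd p (s \<cdot>\<^sub>v y - y $ i \<cdot>\<^sub>v z)"
    unfolding s_def by (rule null_proportional[OF z(1) \<open>null y\<close> i(1)])
  have 2: "vec_dvd p (s \<cdot>\<^sub>v q - q $ i \<cdot>\<^sub>v z)"
    unfolding s_def q_def by (rule null_proportional[OF z(1,2) i(1)])
  have Sy: "S *\<^sub>v y = - (M *\<^sub>v q)"
    unfolding y_def S_mult_M[OF zc] T q_def using zc q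
    by (subst uminus_mult_mat_vec) (auto simp: q_def mult_minus_distrib_mat_vec[of _ n n])
  \<comment> \<open>Since S M z = -M S z, the terms S y and M q cancel when the two
    proportionalities are mapped by S and M and added. The i-th coordinate of what is left is -2 y_i
    q_i.\<close>
  have "vec_dvd p (S *\<^sub>v (s \<cdot>\<^sub>v y - y $ i \<cdot>\<^sub>v z) + M *\<^sub>v (s \<cdot>\<^sub>v q - q $ i \<cdot>\<^sub>v z))"
    using 1 2 by (intro vec_dvd_add vec_dvd_mult_mat) auto
  also have "S *\<^sub>v (s \<cdot>\<^sub>v y - y $ i \<cdot>\<^sub>v z) = s \<cdot>\<^sub>v (S *\<^sub>v y) - y $ i \<cdot>\<^sub>v q"
    using y zc by (simp add: mult_minus_distrib_mat_vec[of _ n n] mult_mat_smult_vec[of _ n n] q_def)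
  also have "M *\<^sub>v (s \<cdot>\<^sub>v q - q $ i \<cdot>\<^sub>v z) = s \<cdot>\<^sub>v (M *\<^sub>v q) - q $ i \<cdot>\<^sub>v y"
    using q zc by (simp add: mult_minus_distrib_mat_vec[of _ n n] mult_mat_smult_vec[of _ n n] y_def)
  finally have "p dvd (s \<cdot>\<^sub>v (S *\<^sub>v y) - y $ i \<cdot>\<^sub>v q + (s \<cdot>\<^sub>v (M *\<^sub>v q) - q $ i \<cdot>\<^sub>v y)) $ i"
    using i y by (auto simp: vec_dvd_def simp del: index_mult_mat_vec)
  also have "(s \<cdot>\<^sub>v (S *\<^sub>v y) - y $ i \<cdot>\<^sub>v q + (s \<cdot>\<^sub>v (M *\<^sub>v q) - q $ i \<cdot>\<^sub>v y)) $ i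
      = - (2 * (y $ i * q $ i))"
    unfolding Sy using i y q by (simp del: index_mult_mat_vec)
  finally have "p dvd 2 * (y $ i * q $ i)" by simp
  moreover have "\<not> p dvd 2"
  proof
    assume "p dvd 2"
    then have "p = 2" using prime_ge_2_int[OF p_prime] zdvd_imp_le[of p 2] by simp
    with p show False by simp
  qed
  ultimately consider "p dvd y $ i" | "p dvd q $ i"
    using p_prime by (auto simp: prime_dvd_mult_iff)
  then show ?thesis
  proof cases
    case 1
    \<comment> \<open>The case y_i = 0 modulo p is impossible: then M z is zero modulo p, although
      \<open>M\<^sup>T M\<close> is l^2 times the identity and p does not divide l.\<close>
    have "vec_dvd p (s \<cdot>\<^sub>v y)"
      using \<open>vec_dvd p (s \<cdot>\<^sub>v y - y $ i \<cdot>\<^sub>v z)\<close> 1 y zc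
      by (auto simp: vec_dvd_def dvd_diff_left_iff)
    then have "vec_dvd p y" using vec_dvd_smult_cancel[OF coprime_p] i s_def by blast
    then have "vec_dvd p ((l * l) \<cdot>\<^sub>v z)"
      unfolding gram_vec[OF zc, symmetric] y_def by (rule vec_dvd_mult_mat)
    moreover have "\<not> p dvd l * l" using l p_prime by (simp add: prime_dvd_mult_iff)
    ultimately have "vec_dvd p z" using vec_dvd_smult_cancel[OF coprime_p] by blast
    with z(3) show ?thesis ..
  next
    case 2
    have "vec_dvd p (s \<cdot>\<^sub>v q)"
      using \<open>vec_dvd p (s \<cdot>\<^sub>v q - q $ i \<cdot>\<^sub>v z)\<close> 2 q zc
      by (auto simp: vec_dvd_def dvd_diff_left_iff)
    then show ?thesis using vec_dvd_smult_cancel[OF coprime_p] i s_def q_def by blast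
  qed
qed

end

section \<open>The level\<close>

definition clears :: "nat \<Rightarrow> rat mat \<Rightarrow> bool" where
  "clears k Q \<longleftrightarrow> (\<forall>i<dim_row Q. \<forall>j<dim_col Q. of_nat k * Q $$ (i,j) \<in> \<int>)"

lemma common_denominator:
  assumes "finite (A :: rat set)"
  shows "\<exists>k::nat. 0 < k \<and> (\<forall>x\<in>A. of_nat k * x \<in> \<int>)"
  using assms
proof induction
  case (insert x A)
  then obtain k :: nat where k: "0 < k" "\<forall>x\<in>A. of_nat k * x \<in> \<int>" by auto
  obtain a b where ab: "quotient_of x = (a, b)" by (cases "quotient_of x")
  then have b: "b > 0" and x: "x = of_int a / of_int b"
    using quotient_of_denom_pos quotient_of_div by auto
  have "of_nat (k * nat b) * y \<in> \<int>" if "y \<in> insert x A" for y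
  proof (cases "y = x")
    case True
    have "of_nat (k * nat b) * y = of_int (int k * a)" using b True x by simp
    then show ?thesis by (simp only: Ints_of_int)
  next
    case False
    then have "of_nat k * y \<in> \<int>" using that k by auto
    then have "of_nat (nat b) * (of_nat k * y) \<in> \<int>" by (rule Ints_mult[OF Ints_of_nat])
    then show ?thesis by (simp add: mult_ac)
  qed
  moreover have "0 < k * nat b" using k b by simp
  ultimately show ?case by blast
qed auto

lemma level_props: "0 < level Q" "clears (level Q) Q"
proof -
  let ?A = "(\<lambda>(i,j). Q $$ (i,j)) ` ({..<dim_row Q} \<times> {..<dim_col Q})"
  have "finite ?A" by simp
  then obtain k :: nat where "0 < k" "\<forall>x\<in>?A. of_nat k * x \<in> \<int>"
    using common_denominator by blast
  then have "\<exists>k>0. clears k Q" by (force simp: clears_def)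
  then have "0 < level Q \<and> clears (level Q) Q"
    unfolding level_def clears_def[symmetric] by (rule LeastI_ex)
  then show "0 < level Q" "clears (level Q) Q" by auto
qed

text \<open>The integers clearing Q are closed under remainders modulo the level, the least positive
  one.\<close>

lemma level_dvd:
  assumes "clears k Q"
  shows "level Q dvd k"
proof -
  have "of_nat (k mod level Q) * x \<in> \<int>"
    if "of_nat k * x \<in> \<int>" "of_nat (level Q) * x \<in> \<int>" for x :: rat
  proof -
    have "of_nat k * x = of_nat (k div level Q) * (of_nat (level Q) * x)
      + of_nat (k mod level Q) * x"
      by (metis (no_types) div_mult_mod_eq of_nat_add of_nat_mult mult.assoc ring_distribs(2))
    then have "of_nat (k mod level Q) * x = of_nat k * x
      - of_nat (k div level Q) * (of_nat (level Q) * x)"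
      by simp
    then show ?thesis using that by (auto intro!: Ints_diff Ints_mult)
  qed
  then have "clears (k mod level Q) Q"
    using assms level_props(2)[of Q] by (auto simp: clears_def)
  moreover have "k mod level Q < level Q" using level_props(1) by simp
  ultimately have "k mod level Q = 0"
    using not_less_Least[of "k mod level Q" "\<lambda>k. 0 < k \<and> clears k Q"]
    unfolding level_def clears_def[symmetric] by auto
  then show ?thesis by auto
qed

lemma clears_int_mat:
  assumes "clears k Q"
  obtains M where "M \<in> carrier_mat (dim_row Q) (dim_col Q)" "rat_mat M = of_nat k \<cdot>\<^sub>m Q"
proof
  let ?M = "map_mat floor (of_nat k \<cdot>\<^sub>m Q)"
  show "?M \<in> carrier_mat (dim_row Q) (dim_col Q)" by simp
  show "rat_mat ?M = of_nat k \<cdot>\<^sub>m Q"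
    using assms by (auto simp: clears_def elim!: Ints_cases)
qed

lemma regular_rat_orth_right_inverse:
  "regular_rat_orth n Q \<Longrightarrow> Q * transpose_mat Q = 1\<^sub>m n"
  unfolding regular_rat_orth_def
  by (intro mat_mult_left_right_inverse[of "transpose_mat Q" n]) auto

lemma regular_rat_orth_conj:
  assumes Q: "regular_rat_orth n Q" and A: "A \<in> carrier_mat n n"
    and eq: "transpose_mat Q * A * Q = B"
  shows "A * Q = Q * B"
proof -
  have Qc: "Q \<in> carrier_mat n n" "transpose_mat Q \<in> carrier_mat n n"
    using Q by (auto simp: regular_rat_orth_def)
  have "Q * B = (Q * transpose_mat Q) * (A * Q)"
    unfolding eq[symmetric] using Qc A by (simp add: assoc_mult_mat[of _ n n _ n _ n])
  then show ?thesis using regular_rat_orth_right_inverse[OF Q] Qc A by simp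
qed

lemma scaled_conj_ex:
  assumes S: "skew_int_mat n S" and T: "skew_int_mat n T"
    and Q: "regular_rat_orth n Q" and conj: "transpose_mat Q * rat_mat S * Q = rat_mat T"
  obtains M where "scaled_conj n S T M (int (level Q))" "rat_mat M = of_nat (level Q) \<cdot>\<^sub>m Q"
proof -
  interpret S: skew_int_mat n S by fact
  interpret T: skew_int_mat n T by fact
  let ?l = "level Q"
  have Qc: "Q \<in> carrier_mat n n" and orth: "transpose_mat Q * Q = 1\<^sub>m n"
    and one: "Q *\<^sub>v all_one_vec n = all_one_vec n"
    using Q by (auto simp: regular_rat_orth_def)
  obtain M where M: "M \<in> carrier_mat n n" "rat_mat M = of_nat ?l \<cdot>\<^sub>m Q"
    using clears_int_mat[OF level_props(2)[of Q]] Qc by auto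
  have R: "rat_mat S \<in> carrier_mat n n" "rat_mat T \<in> carrier_mat n n" by auto
  have tM: "rat_mat (transpose_mat M) = of_nat ?l \<cdot>\<^sub>m transpose_mat Q"
    unfolding map_mat_transpose[symmetric] M(2) by auto
  have "scaled_conj n S T M (int ?l)"
  proof unfold_locales
    show "M \<in> carrier_mat n n" by fact
    show "int ?l \<noteq> 0" using level_props(1)[of Q] by simp
    have "rat_mat (transpose_mat M * M) = rat_mat ((int ?l * int ?l) \<cdot>\<^sub>m 1\<^sub>m n)"
    proof -
      have "rat_mat (transpose_mat M * M) = (of_nat ?l \<cdot>\<^sub>m transpose_mat Q) * (of_nat ?l \<cdot>\<^sub>m Q)"
        unfolding tM[symmetric] M(2)[symmetric] using M(1)
        by (intro of_int_hom.mat_hom_mult[of _ n n _ n]) auto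
      also have "\<dots> = (of_nat ?l * of_nat ?l) \<cdot>\<^sub>m (transpose_mat Q * Q)"
        using Qc by (auto simp: mult_smult_assoc_mat[of _ n n _ n] mult_smult_distrib[of _ n n _ n])
      also have "\<dots> = rat_mat ((int ?l * int ?l) \<cdot>\<^sub>m 1\<^sub>m n)"
        unfolding orth by auto
      finally show ?thesis .
    qed
    then show "transpose_mat M * M = (int ?l * int ?l) \<cdot>\<^sub>m 1\<^sub>m n"
      by (rule of_int_hom.mat_hom_inj)
    have "rat_mat (S * M) = rat_mat (M * T)"
    proof -
      have "rat_mat (S * M) = rat_mat S * (of_nat ?l \<cdot>\<^sub>m Q)"
        unfolding M(2)[symmetric] using M(1) by (intro of_int_hom.mat_hom_mult[of _ n n _ n]) auto
      also have "\<dots> = of_nat ?l \<cdot>\<^sub>m (Q * rat_mat T)"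
        unfolding mult_smult_distrib[OF R(1) Qc] regular_rat_orth_conj[OF Q R(1) conj] ..
      also have "\<dots> = rat_mat M * rat_mat T"
        unfolding M(2) mult_smult_assoc_mat[OF Qc R(2)] ..
      also have "\<dots> = rat_mat (M * T)"
        using M(1) by (intro of_int_hom.mat_hom_mult[symmetric, of _ n n _ n]) auto
      finally show ?thesis .
    qed
    then show "S * M = M * T" by (rule of_int_hom.mat_hom_inj)
    have e: "map_vec rat_of_int (all_one_vec n) = all_one_vec n" by (auto simp: all_one_vec_def)
    have "map_vec rat_of_int (M *\<^sub>v all_one_vec n) = map_vec rat_of_int (int ?l \<cdot>\<^sub>v all_one_vec n)"
      unfolding of_int_hom.mult_mat_vec_hom[OF M(1) all_one_vec_carrier] M(2) e
        smult_mat_mult_vec[OF Qc all_one_vec_carrier] one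
      by (auto simp: all_one_vec_def)
    then show "M *\<^sub>v all_one_vec n = int ?l \<cdot>\<^sub>v all_one_vec n"
      by (rule of_int_hom.vec_hom_inj)
  qed
  then show ?thesis using M(2) by (rule that)
qed

text \<open>Otherwise level / p would already clear Q. Such a column supplies a vector that is
  nonzero modulo p in the later arguments.\<close>

lemma prime_dvd_level_col:
  assumes Q: "Q \<in> carrier_mat n n" and M: "M \<in> carrier_mat n n" "rat_mat M = of_nat (level Q) \<cdot>\<^sub>m Q"
    and p: "prime (p::nat)" "p dvd level Q"
  obtains j where "j < n" "\<not> vec_dvd (int p) (M *\<^sub>v unit_vec n j)"
proof (rule ccontr)
  note obtained = that
  assume "\<not> thesis"
  then have all: "vec_dvd (int p) (M *\<^sub>v unit_vec n j)" if "j < n" for j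
    using obtained that by blast
  obtain k where k: "level Q = p * k" using p(2) by (rule dvdE)
  have "clears k Q"
    unfolding clears_def
  proof (intro allI impI)
    fix i j assume "i < dim_row Q" "j < dim_col Q"
    then have ij: "i < n" "j < n" using Q by auto
    have "int p dvd M $$ (i,j)" using all[OF ij(2)] ij M(1) by (auto simp: vec_dvd_def)
    then obtain t where t: "M $$ (i,j) = int p * t" by (rule dvdE)
    have "of_int (M $$ (i,j)) = rat_of_nat (level Q) * Q $$ (i,j)"
      using arg_cong[OF M(2), of "\<lambda>A. A $$ (i,j)"] ij M(1) Q by simp
    then have "of_int (int p * t) = rat_of_nat (p * k) * Q $$ (i,j)"
      by (simp only: t k)
    then have "of_nat p * (rat_of_nat k * Q $$ (i,j)) = of_nat p * of_int t"
      by (simp only: of_int_mult of_int_of_nat_eq of_nat_mult mult.assoc)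
    then have "rat_of_nat k * Q $$ (i,j) = of_int t"
      using prime_gt_0_nat[OF p(1)] by auto
    then show "rat_of_nat k * Q $$ (i,j) \<in> \<int>" by simp
  qed
  then have "level Q dvd k" by (rule level_dvd)
  moreover have "0 < k" "1 < p" using level_props(1)[of Q] k prime_gt_1_nat[OF p(1)] by auto
  ultimately show False using k dvd_imp_le[of "level Q" k] by auto
qed

context scaled_conj
begin

lemma dvd_det_mult_M:
  assumes x: "x \<in> carrier_vec n"
  shows "vec_dvd l (det S.W \<cdot>\<^sub>v (M *\<^sub>v x))"
proof -
  have "vec_dvd l (transpose_mat S.W *\<^sub>v (M *\<^sub>v x))"
    by (auto simp: vec_dvd_def S.col_W walk_vec_scalar_col[OF x])
  then have "vec_dvd l (adj_mat (transpose_mat S.W) *\<^sub>v (transpose_mat S.W *\<^sub>v (M *\<^sub>v x)))"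
    by (rule vec_dvd_mult_mat)
  also have "adj_mat (transpose_mat S.W) *\<^sub>v (transpose_mat S.W *\<^sub>v (M *\<^sub>v x))
    = det S.W \<cdot>\<^sub>v (M *\<^sub>v x)"
    using x by (subst adj_mat_mult_mult(1)[of _ n]) (auto simp: det_transpose[of _ n])
  finally show ?thesis .
qed

text \<open>Multiplying \<open>W\<^sup>T M x\<close>, which is divisible by l, by the adjugate shows
  that det W times Q is integral. An odd prime that divides det W only once therefore divides the
  level at most once.\<close>

lemma level_dvd_det:
  assumes Q: "Q \<in> carrier_mat n n" and M: "rat_mat M = of_nat (level Q) \<cdot>\<^sub>m Q" and l: "l
    = int (level Q)"
  shows "int (level Q) dvd det S.W"
proof -
  have "clears (nat \<bar>det S.W\<bar>) Q"
    unfolding clears_def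
  proof (intro allI impI)
    fix i j assume "i < dim_row Q" "j < dim_col Q"
    then have ij: "i < n" "j < n" using Q by auto
    have "l dvd det S.W * M $$ (i,j)"
      using dvd_det_mult_M[of "unit_vec n j"] ij by (auto simp: vec_dvd_def)
    then obtain t where t: "det S.W * M $$ (i,j) = l * t" by (rule dvdE)
    have "of_int (M $$ (i,j)) = rat_of_nat (level Q) * Q $$ (i,j)"
      using arg_cong[OF M, of "\<lambda>A. A $$ (i,j)"] ij Q by simp
    then have "rat_of_nat (level Q) * (of_int (det S.W) * Q $$ (i,j))
      = rat_of_nat (level Q) * of_int t"
      using arg_cong[OF t, of rat_of_int] by (simp add: l mult.left_commute)
    then have "of_int (det S.W) * Q $$ (i,j) \<in> \<int>"
      using level_props(1)[of Q] by simp
    then have "\<bar>of_int (det S.W)\<bar> * Q $$ (i,j) \<in> \<int>"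
      by (cases "det S.W \<ge> 0") (auto simp: minus_in_Ints_iff)
    then show "of_nat (nat \<bar>det S.W\<bar>) * Q $$ (i,j) \<in> \<int>" by simp
  qed
  then have "level Q dvd nat \<bar>det S.W\<bar>" by (rule level_dvd)
  then show ?thesis using int_dvd_int_iff[of "level Q" "nat \<bar>det S.W\<bar>"] by simp
qed

end

section \<open>Local consequences for the graphs in the class\<close>

lemma in_G_walk_two:
  assumes "in_G n S" "0 < n"
  shows "walk_two n S (det (walk_mat n S) div 2 ^ (n div 2))"
proof -
  interpret skew_int_mat n S using assms by (intro oriented_graph_skew) (simp add: in_G_def)
  show ?thesis by unfold_locales (use assms in \<open>auto simp: in_G_def\<close>)
qed

lemma in_G_walk_prime:
  assumes "in_G n S" and p: "prime p" "odd p"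
  shows "walk_prime n S p"
proof -
  interpret skew_int_mat n S using assms by (intro oriented_graph_skew) (simp add: in_G_def)
  define b where "b = det W div 2 ^ (n div 2)"
  have b: "det W = 2 ^ (n div 2) * b" "squarefree b" using assms by (auto simp: in_G_def b_def)
  have "\<not> p * p dvd det W"
  proof
    assume "p * p dvd det W"
    moreover have "coprime (p * p) (2 ^ (n div 2))" using p by auto
    ultimately have "p\<^sup>2 dvd b" by (simp add: b(1) coprime_dvd_mult_right_iff power2_eq_square)
    then have "p dvd 1" using b(2) by (auto simp: squarefree_def)
    then show False using p by auto
  qed
  then show ?thesis using p by unfold_locales
qed

text \<open>For even level l all columns of M = l Q satisfy the hypotheses of
  \<open>walk_two_even\<close>, because M x . S^k M x = l^2 (x . T^k x).\<close>

lemma odd_level: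
  assumes S: "in_G n S" and T: "skew_int_mat n T"
    and Q: "regular_rat_orth n Q" and conj: "transpose_mat Q * rat_mat S * Q = rat_mat T"
  shows "odd (level Q)"
proof
  assume even: "even (level Q)"
  have Qc: "Q \<in> carrier_mat n n" using Q by (simp add: regular_rat_orth_def)
  have sS: "skew_int_mat n S" using S by (intro oriented_graph_skew) (simp add: in_G_def)
  obtain M where M: "scaled_conj n S T M (int (level Q))" "rat_mat M = of_nat (level Q) \<cdot>\<^sub>m Q"
    using scaled_conj_ex[OF sS T Q conj] .
  interpret scaled_conj n S T M "int (level Q)" by fact
  obtain j where j: "j < n" "\<not> vec_dvd (int 2) (M *\<^sub>v unit_vec n j)"
    using prime_dvd_level_col[OF Qc M_carrier M(2) two_is_prime_nat even] .
  interpret two: walk_two n S "det (walk_mat n S) div 2 ^ (n div 2)"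
    using in_G_walk_two[OF S] j by simp
  have "vec_dvd 2 (M *\<^sub>v unit_vec n j)"
  proof (rule two.walk_two_even)
    show "even (S.walk_vec k \<bullet> (M *\<^sub>v unit_vec n j))" for k
      using even by (simp add: walk_vec_scalar_col)
    show "4 dvd (M *\<^sub>v unit_vec n j) \<bullet> (S ^\<^sub>m k *\<^sub>v (M *\<^sub>v unit_vec n j))" for k
    proof -
      have "2 * 2 dvd int (level Q) * int (level Q)" using even by (intro mult_dvd_mono) auto
      then show ?thesis
        by (simp add: pow_S_mult_M scalar_prod_M mult_mat_vec_carrier[of _ n n])
    qed
  qed simp
  with j show False by simp
qed

text \<open>The witness is a column z of M = l Q that is nonzero modulo p. It is null with p | z.z,
  and S z is null too, being M applied to a column of T. If p did not divide the level of
  \<open>Q0\<close>, S would kill z modulo p, which isotropic null vectors exclude.\<close>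

lemma prime_dvd_level_dvd_converse_level:
  assumes S: "in_G n S" and T: "skew_int_mat n T"
    and Q: "regular_rat_orth n Q" "transpose_mat Q * rat_mat S * Q = rat_mat T"
    and Q0: "regular_rat_orth n Q0" "transpose_mat Q0 * rat_mat S * Q0 = rat_mat (- S)"
    and p: "prime p" "p dvd level Q"
  shows "p dvd level Q0"
proof (rule ccontr)
  assume np: "\<not> p dvd level Q0"
  have Qc: "Q \<in> carrier_mat n n" using Q by (simp add: regular_rat_orth_def)
  have sS: "skew_int_mat n S" using S by (intro oriented_graph_skew) (simp add: in_G_def)
  then have sN: "skew_int_mat n (- S)"
    by (auto simp: skew_int_mat_def square_int_mat_def skew_int_mat_axioms_def transpose_uminus)
  obtain M where M: "scaled_conj n S T M (int (level Q))" "rat_mat M = of_nat (level Q) \<cdot>\<^sub>m Q"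
    using scaled_conj_ex[OF sS T Q] .
  obtain M0 where M0: "scaled_conj n S (- S) M0 (int (level Q0))"
    using scaled_conj_ex[OF sS sN Q0] .
  have odd: "odd p" using p odd_level[OF S T Q] by auto
  interpret walk_prime n S "int p" using in_G_walk_prime[OF S, of "int p"] p odd by simp
  interpret Q: walk_prime_conj n S "int p" T M "int (level Q)"
    using M(1) walk_prime_axioms by (simp add: walk_prime_conj_def)
  interpret Q0: walk_prime_conj n S "int p" "- S" M0 "int (level Q0)"
    using M0 walk_prime_axioms by (simp add: walk_prime_conj_def)
  obtain j where j: "j < n" "\<not> vec_dvd (int p) (M *\<^sub>v unit_vec n j)"
    using prime_dvd_level_col[OF Qc Q.M_carrier M(2) p] .
  define z where "z = M *\<^sub>v unit_vec n j"
  have pl: "int p dvd int (level Q)" using p by simp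
  have z: "null z" unfolding z_def by (rule Q.null_col[OF pl]) simp
  have Sz: "null (S *\<^sub>v z)"
    unfolding z_def Q.S_mult_M[OF unit_vec_carrier]
    by (rule Q.null_col[OF pl]) (auto intro!: mult_mat_vec_carrier[of _ n n])
  have "int p dvd z \<bullet> z" using pl unfolding z_def by (simp add: Q.scalar_prod_M)
  moreover have "vec_dvd (int p) (S *\<^sub>v z)"
    by (rule Q0.converse_conj_kills_null) (use np odd z Sz j in \<open>auto simp: z_def\<close>)
  ultimately show False using isotropic_null_not_killed[OF z] j by (simp add: z_def)
qed

section \<open>Permutation matrices and the count of mates\<close>

text \<open>In each row both the entries and their squares sum to 1. The terms x^2 - x are
  nonnegative for integers and sum to 0, so each vanishes.\<close>

lemma integral_orthogonal_entries:
  assumes P: "P \<in> carrier_mat n n" and right: "P * transpose_mat P = 1\<^sub>m n"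
    and one: "P *\<^sub>v all_one_vec n = all_one_vec n"
    and i: "i < n" and j: "j < n"
  shows "P $$ (i,j) = 0 \<or> P $$ (i,j) = (1::int)"
proof -
  have "(P * transpose_mat P) $$ (i,i) = 1" using i by (simp add: right)
  then have sq: "(\<Sum>k\<in>{0..<n}. P $$ (i,k) * P $$ (i,k)) = 1"
    using P i by (simp add: scalar_prod_def)
  have "(P *\<^sub>v all_one_vec n) $ i = 1" using i by (simp add: one)
  then have sum: "(\<Sum>k\<in>{0..<n}. P $$ (i,k)) = 1"
    using P i by (simp add: scalar_prod_def)
  have nonneg: "x * x - x \<ge> 0" for x :: int
    by (cases "x \<le> 0") (auto simp: mult_le_cancel_left1 intro: order_trans[of _ 0])
  have "(\<Sum>k\<in>{0..<n}. P $$ (i,k) * P $$ (i,k) - P $$ (i,k)) = 0"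
    using sq sum by (simp add: sum_subtractf)
  then have "P $$ (i,j) * P $$ (i,j) - P $$ (i,j) = 0"
    using j nonneg by (subst (asm) sum_nonneg_eq_0_iff) auto
  then have "P $$ (i,j) * (P $$ (i,j) - 1) = 0" by (simp add: algebra_simps)
  then show ?thesis by simp
qed

lemma integral_orthogonal_perm_mat:
  fixes P :: "int mat"
  assumes P: "P \<in> carrier_mat n n" and right: "P * transpose_mat P = 1\<^sub>m n"
    and one: "P *\<^sub>v all_one_vec n = all_one_vec n"
  obtains \<sigma> where "\<sigma> permutes {..<n}" "P = perm_mat n \<sigma>"
proof -
  note entries = integral_orthogonal_entries[OF P right one]
  have row: "\<exists>!j. j < n \<and> P $$ (i,j) = 1" if i: "i < n" for i
  proof -
    have "(P *\<^sub>v all_one_vec n) $ i = 1" using i by (simp add: one)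
    then have sum: "(\<Sum>k\<in>{0..<n}. P $$ (i,k)) = 1"
      using P i by (simp add: scalar_prod_def)
    have "(\<Sum>k\<in>{0..<n}. P $$ (i,k)) = (\<Sum>k\<in>{0..<n}. if P $$ (i,k) = 1 then 1 else 0)"
      by (intro sum.cong) (use entries[OF i] in auto)
    also have "\<dots> = int (card {k \<in> {0..<n}. P $$ (i,k) = 1})"
      by (subst sum.inter_filter[symmetric]) simp_all
    finally have "card {k \<in> {0..<n}. P $$ (i,k) = 1} = 1" using sum by simp
    then obtain j where "{k \<in> {0..<n}. P $$ (i,k) = 1} = {j}" by (rule card_1_singletonE)
    then have "k < n \<and> P $$ (i,k) = 1 \<longleftrightarrow> k = j" for k by auto
    then show ?thesis by auto
  qed
  define \<sigma> where "\<sigma> i = (if i < n then THE j. j < n \<and> P $$ (i,j) = 1 else i)" for i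
  have \<sigma>: "\<sigma> i < n" "P $$ (i, \<sigma> i) = 1" if "i < n" for i
    using theI'[OF row[OF that]] that by (auto simp: \<sigma>_def)
  have eq: "P $$ (i,j) = (if \<sigma> i = j then 1 else 0)" if "i < n" "j < n" for i j
    using \<sigma>[OF that(1)] row[OF that(1)] entries[OF that] that by auto
  have "inj_on \<sigma> {..<n}"
  proof (rule inj_onI, rule ccontr)
    fix i k assume ik: "i \<in> {..<n}" "k \<in> {..<n}" "\<sigma> i = \<sigma> k" "i \<noteq> k"
    have "(P * transpose_mat P) $$ (i,k) = (\<Sum>j\<in>{0..<n}. P $$ (i,j) * P $$ (k,j))"
      using P ik by (simp add: scalar_prod_def)
    also have "\<dots> = (\<Sum>j\<in>{0..<n}. if \<sigma> k = j then 1 else 0)"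
      using ik by (intro sum.cong) (auto simp: eq)
    also have "\<dots> = 1" using \<sigma>(1)[of k] ik by simp
    finally show False using ik by (simp add: right)
  qed
  moreover have "\<sigma> ` {..<n} \<subseteq> {..<n}" using \<sigma> by auto
  ultimately have "bij_betw \<sigma> {..<n} {..<n}"
    by (simp add: bij_betw_def endo_inj_surj)
  then have "\<sigma> permutes {..<n}" by (rule bij_imp_permutes) (simp add: \<sigma>_def)
  moreover have "P = perm_mat n \<sigma>"
    using P by (intro eq_matI) (auto simp: perm_mat_def eq)
  ultimately show ?thesis by (rule that)
qed

section \<open>Isomorphism as conjugation by integral regular orthogonal matrices\<close>

lemma perm_mat_orthogonal:
  assumes \<sigma>: "\<sigma> permutes {..<n}"
  shows "perm_mat n \<sigma> \<in> carrier_mat n n" "transpose_mat (perm_mat n \<sigma>) * perm_mat n \<sigma> = 1\<^sub>m n"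
    "perm_mat n \<sigma> *\<^sub>v all_one_vec n = all_one_vec n"
proof -
  show c: "perm_mat n \<sigma> \<in> carrier_mat n n" by (simp add: perm_mat_def)
  show "transpose_mat (perm_mat n \<sigma>) * perm_mat n \<sigma> = 1\<^sub>m n"
  proof (rule eq_matI)
    fix j k assume "j < dim_row (1\<^sub>m n :: int mat)" "k < dim_col (1\<^sub>m n :: int mat)"
    then have jk: "j < n" "k < n" by auto
    have "(transpose_mat (perm_mat n \<sigma>) * perm_mat n \<sigma>) $$ (j,k)
        = (\<Sum>i\<in>{..<n}. (if \<sigma> i = j then 1 else 0) * (if \<sigma> i = k then 1 else 0))"
      using jk by (simp add: perm_mat_def scalar_prod_def lessThan_atLeast0)
    also have "\<dots> = (\<Sum>i\<in>{..<n}. (if i = j then 1 else 0) * (if i = k then 1 else 0))"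
      using sum.permute[OF \<sigma>, of "\<lambda>i. (if i = j then 1 else 0) * (if i = k then 1 else 0 :: int)"]
      by (simp add: comp_def)
    also have "\<dots> = (\<Sum>i\<in>{..<n}. if i = j then (if j = k then 1 else 0) else 0)"
      by (intro sum.cong) auto
    also have "\<dots> = 1\<^sub>m n $$ (j,k)" using jk by simp
    finally show "(transpose_mat (perm_mat n \<sigma>) * perm_mat n \<sigma>) $$ (j,k) = 1\<^sub>m n $$ (j,k)" .
  qed (simp_all add: perm_mat_def)
  show "perm_mat n \<sigma> *\<^sub>v all_one_vec n = all_one_vec n"
  proof (rule eq_vecI)
    fix i assume "i < dim_vec (all_one_vec n :: int vec)"
    then have "i < n" by simp
    moreover from this have "\<sigma> i < n" using permutes_in_image[OF \<sigma>, of i] by simp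
    ultimately show "(perm_mat n \<sigma> *\<^sub>v all_one_vec n) $ i = all_one_vec n $ i"
      by (simp add: perm_mat_def scalar_prod_def)
  qed (simp add: perm_mat_def)
qed

lemma int_orthogonal_right_inverse:
  fixes P :: "int mat"
  assumes P: "P \<in> carrier_mat n n" and orth: "transpose_mat P * P = 1\<^sub>m n"
  shows "P * transpose_mat P = 1\<^sub>m n"
proof -
  have hom: "rat_mat (A * B) = rat_mat A * rat_mat B"
    if "A \<in> carrier_mat n n" "B \<in> carrier_mat n n" for A B
    using that by (rule of_int_hom.mat_hom_mult)
  have "rat_mat (transpose_mat P) * rat_mat P = 1\<^sub>m n"
    using P hom[of "transpose_mat P" P] by (simp add: orth of_int_hom.mat_hom_one)
  then have "rat_mat P * rat_mat (transpose_mat P) = 1\<^sub>m n"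
    by (rule mat_mult_left_right_inverse[rotated 2]) (use P in auto)
  then have "rat_mat (P * transpose_mat P) = rat_mat (1\<^sub>m n)"
    using P hom[of P "transpose_mat P"] by (simp add: of_int_hom.mat_hom_one)
  then show ?thesis by (rule of_int_hom.mat_hom_inj)
qed

text \<open>This form makes symmetry and transitivity plain matrix algebra, and it applies directly
  to a regular rational orthogonal matrix of level 1.\<close>

lemma og_iso_iff:
  "og_iso n A B \<longleftrightarrow> (\<exists>P\<in>carrier_mat n n. transpose_mat P * P = 1\<^sub>m n
    \<and> P *\<^sub>v all_one_vec n = all_one_vec n \<and> B = transpose_mat P * A * P)"
proof
  assume "og_iso n A B"
  then show "\<exists>P\<in>carrier_mat n n. transpose_mat P * P = 1\<^sub>m n
    \<and> P *\<^sub>v all_one_vec n = all_one_vec n \<and> B = transpose_mat P * A * P"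
    unfolding og_iso_def using perm_mat_orthogonal by metis
next
  assume "\<exists>P\<in>carrier_mat n n. transpose_mat P * P = 1\<^sub>m n
    \<and> P *\<^sub>v all_one_vec n = all_one_vec n \<and> B = transpose_mat P * A * P"
  then obtain P where P: "P \<in> carrier_mat n n" "transpose_mat P * P = 1\<^sub>m n"
    "P *\<^sub>v all_one_vec n = all_one_vec n" and B: "B = transpose_mat P * A * P" by auto
  obtain \<sigma> where "\<sigma> permutes {..<n}" "P = perm_mat n \<sigma>"
    using integral_orthogonal_perm_mat[OF P(1) int_orthogonal_right_inverse[OF P(1,2)] P(3)] .
  then show "og_iso n A B" using B by (auto simp: og_iso_def)
qed

lemma og_iso_sym:
  assumes A: "A \<in> carrier_mat n n" and "og_iso n A B"
  shows "og_iso n B A"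
proof -
  obtain P where P: "P \<in> carrier_mat n n" "transpose_mat P * P = 1\<^sub>m n"
    "P *\<^sub>v all_one_vec n = all_one_vec n" and B: "B = transpose_mat P * A * P"
    using assms by (auto simp: og_iso_iff)
  have tP: "transpose_mat P \<in> carrier_mat n n" using P by simp
  have right: "P * transpose_mat P = 1\<^sub>m n" using P(1,2) by (rule int_orthogonal_right_inverse)
  have "transpose_mat P *\<^sub>v all_one_vec n = transpose_mat P *\<^sub>v (P *\<^sub>v all_one_vec n)"
    by (simp add: P(3))
  also have "\<dots> = all_one_vec n"
    using assoc_mult_mat_vec[OF tP P(1) all_one_vec_carrier] by (simp add: P(2))
  finally have one: "transpose_mat P *\<^sub>v all_one_vec n = all_one_vec n" .
  have "P * B * transpose_mat P = (P * transpose_mat P) * A * (P * transpose_mat P)"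
    unfolding B using P(1) tP A by (simp
      add: assoc_mult_mat[of _ n n _ n _ n] mult_carrier_mat[of _ n n])
  also have "\<dots> = A" using A by (simp add: right)
  finally have "A = transpose_mat (transpose_mat P) * B * transpose_mat P" by simp
  then show ?thesis
    unfolding og_iso_iff using tP right one by (intro bexI[of _ "transpose_mat P"]) simp_all
qed

lemma og_iso_trans:
  assumes A: "A \<in> carrier_mat n n" and "og_iso n A B" "og_iso n B D"
  shows "og_iso n A D"
proof -
  obtain P where P: "P \<in> carrier_mat n n" "transpose_mat P * P = 1\<^sub>m n"
    "P *\<^sub>v all_one_vec n = all_one_vec n" and B: "B = transpose_mat P * A * P"
    using assms by (auto simp: og_iso_iff)
  obtain R where R: "R \<in> carrier_mat n n" "transpose_mat R * R = 1\<^sub>m n"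
    "R *\<^sub>v all_one_vec n = all_one_vec n" and D: "D = transpose_mat R * B * R"
    using assms by (auto simp: og_iso_iff)
  have c: "P * R \<in> carrier_mat n n" "transpose_mat P \<in> carrier_mat n n"
    "transpose_mat R \<in> carrier_mat n n" using P R by auto
  have t: "transpose_mat (P * R) = transpose_mat R * transpose_mat P"
    using P(1) R(1) by (rule transpose_mult)
  have "transpose_mat (P * R) * (P * R) = transpose_mat R * (transpose_mat P * P) * R"
    unfolding t using c P(1) R(1) by (simp
      add: assoc_mult_mat[of _ n n _ n _ n] mult_carrier_mat[of _ n n])
  also have "\<dots> = 1\<^sub>m n" using c R by (simp add: P(2))
  finally have orth: "transpose_mat (P * R) * (P * R) = 1\<^sub>m n" .
  have one: "(P * R) *\<^sub>v all_one_vec n = all_one_vec n"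
    using P R by (simp add: assoc_mult_mat_vec[of _ n n _ n])
  have "D = transpose_mat (P * R) * A * (P * R)"
    unfolding t D B using c P(1) R(1) A
    by (simp add: assoc_mult_mat[of _ n n _ n _ n] mult_carrier_mat[of _ n n])
  then show ?thesis
    unfolding og_iso_iff using c(1) orth one by blast
qed

text \<open>\<open>Q1\<^sup>T Q2\<close> conjugates T1 to T2, and it is integral: its level divides
  l1 l2, and a prime p in it divides both levels. By \<open>isotropic_line_unique\<close> p^2
  divides all scalar products of columns of M1 with columns of M2, so (l1 / p)(l2 / p) also clears
  the matrix, yet p no longer divides that number.\<close>

lemma same_level_primes_og_iso:
  assumes S: "in_G n S"
    and T1: "skew_int_mat n T1" and T2: "skew_int_mat n T2"
    and Q1: "regular_rat_orth n Q1" "transpose_mat Q1 * rat_mat S * Q1 = rat_mat T1"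
    and Q2: "regular_rat_orth n Q2" "transpose_mat Q2 * rat_mat S * Q2 = rat_mat T2"
    and primes: "prime_factors (level Q1) = prime_factors (level Q2)"
  shows "og_iso n T1 T2"
proof -
  have sS: "skew_int_mat n S" using S by (intro oriented_graph_skew) (simp add: in_G_def)
  interpret S: skew_int_mat n S by fact
  interpret T1: skew_int_mat n T1 by fact
  interpret T2: skew_int_mat n T2 by fact
  have c: "Q1 \<in> carrier_mat n n" "Q2 \<in> carrier_mat n n"
    "transpose_mat Q1 \<in> carrier_mat n n" "transpose_mat Q2 \<in> carrier_mat n n"
    and orth: "transpose_mat Q1 * Q1 = 1\<^sub>m n" "transpose_mat Q2 * Q2 = 1\<^sub>m n"
    and one: "Q1 *\<^sub>v all_one_vec n = all_one_vec n" "Q2 *\<^sub>v all_one_vec n = all_one_vec n"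
    using Q1(1) Q2(1) by (auto simp: regular_rat_orth_def)
  have right: "Q1 * transpose_mat Q1 = 1\<^sub>m n"
    using Q1(1) by (rule regular_rat_orth_right_inverse)
  have R: "rat_mat S \<in> carrier_mat n n" "rat_mat T1 \<in> carrier_mat n n" by auto
  obtain M1 where M1: "scaled_conj n S T1 M1 (int (level Q1))" "rat_mat M1
    = of_nat (level Q1) \<cdot>\<^sub>m Q1"
    using scaled_conj_ex[OF sS T1 Q1] .
  obtain M2 where M2: "scaled_conj n S T2 M2 (int (level Q2))" "rat_mat M2
    = of_nat (level Q2) \<cdot>\<^sub>m Q2"
    using scaled_conj_ex[OF sS T2 Q2] .
  interpret M1: scaled_conj n S T1 M1 "int (level Q1)" by fact
  interpret M2: scaled_conj n S T2 M2 "int (level Q2)" by fact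
  define Q where "Q = transpose_mat Q1 * Q2"
  have Qc: "Q \<in> carrier_mat n n" using c by (simp add: Q_def)
  have tQ: "transpose_mat Q = transpose_mat Q2 * Q1"
    unfolding Q_def using c transpose_mult[OF c(3,2)] by simp
  have Q_entry: "of_nat (level Q1 * level Q2) * Q $$ (i,j)
      = of_int ((M1 *\<^sub>v unit_vec n i) \<bullet> (M2 *\<^sub>v unit_vec n j))" if ij: "i < n" "j < n" for i j
  proof -
    have "(M1 *\<^sub>v unit_vec n i) \<bullet> (M2 *\<^sub>v unit_vec n j) = (transpose_mat M1 * M2) $$ (i,j)"
    proof -
      have "M1 *\<^sub>v unit_vec n i = col M1 i" "M2 *\<^sub>v unit_vec n j = col M2 j"
        using ij by auto
      then show ?thesis using ij by simp
    qed
    then have "of_int ((M1 *\<^sub>v unit_vec n i) \<bullet> (M2 *\<^sub>v unit_vec n j))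
      = rat_mat (transpose_mat M1 * M2) $$ (i,j)"
      using ij by simp
    also have "rat_mat (transpose_mat M1 * M2) = transpose_mat (rat_mat M1) * rat_mat M2"
      unfolding map_mat_transpose by (rule of_int_hom.mat_hom_mult[of _ n n _ n]) simp_all
    also have "\<dots> $$ (i,j) = of_nat (level Q1 * level Q2) * Q $$ (i,j)"
      unfolding M1(2) M2(2) Q_def using c ij
      by (simp add: scalar_prod_def sum_distrib_left mult_ac)
    finally show ?thesis ..
  qed
  have clears12: "clears (level Q1 * level Q2) Q"
    unfolding clears_def using Qc by (auto simp only: carrier_matD Q_entry Ints_of_int)
  have simple: "\<not> p dvd k" if p: "prime p" "odd p" and k: "p * k = level Q'"
    and Q': "int (level Q') dvd det S.W" for p k Q'
  proof
    interpret walk_prime n S "int p" using in_G_walk_prime[OF S, of "int p"] p by simp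
    assume "p dvd k"
    then have "p * p dvd level Q'" unfolding k[symmetric] by simp
    then have "int (p * p) dvd int (level Q')" by (simp only: int_dvd_int_iff)
    then have "int p * int p dvd det S.W" using Q' by (metis dvd_trans of_nat_mult)
    with p_simple show False ..
  qed
  have "level Q = 1"
  proof (rule ccontr)
    assume "level Q \<noteq> 1"
    then obtain p where p: "prime p" "p dvd level Q" using prime_factor_nat by blast
    have "p dvd level Q1 * level Q2" using p(2) level_dvd[OF clears12] by (rule dvd_trans)
    then have "p dvd level Q1 \<or> p dvd level Q2" using p(1) by (simp add: prime_dvd_mult_iff)
    then have pl: "p dvd level Q1" "p dvd level Q2"
      using primes p(1) level_props(1)[of Q1] level_props(1)[of Q2]
      by (auto simp: prime_factors_dvd set_eq_iff)
    have odd: "odd p" using pl odd_level[OF S T1 Q1] by auto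
    interpret walk_prime n S "int p" using in_G_walk_prime[OF S, of "int p"] p odd by simp
    interpret P1: walk_prime_conj n S "int p" T1 M1 "int (level Q1)"
      using M1(1) walk_prime_axioms by (simp add: walk_prime_conj_def)
    interpret P2: walk_prime_conj n S "int p" T2 M2 "int (level Q2)"
      using M2(1) walk_prime_axioms by (simp add: walk_prime_conj_def)
    obtain a where a: "level Q1 = p * a" using pl(1) by (rule dvdE)
    obtain b where b: "level Q2 = p * b" using pl(2) by (rule dvdE)
    obtain i0 where i0: "i0 < n" "\<not> vec_dvd (int p) (M1 *\<^sub>v unit_vec n i0)"
      using prime_dvd_level_col[OF c(1) M1.M_carrier M1(2) p(1) pl(1)] .
    obtain j0 where j0: "j0 < n" "\<not> vec_dvd (int p) (M2 *\<^sub>v unit_vec n j0)"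
      using prime_dvd_level_col[OF c(2) M2.M_carrier M2(2) p(1) pl(2)] .
    \<comment> \<open>Columns nonzero modulo p, one for each lattice; the columns under comparison
      may vanish modulo p and then do not show the null line.\<close>
    define x0 where "x0 = M1 *\<^sub>v unit_vec n i0"
    define y0 where "y0 = M2 *\<^sub>v unit_vec n j0"
    have null0: "null x0" unfolding x0_def using pl by (intro P1.null_col) auto
    have x0c: "x0 \<in> carrier_vec n" by (simp add: x0_def)
    obtain r where r: "r < n" "\<not> int p dvd x0 $ r"
      using i0(2) x0c by (auto simp: vec_dvd_def x0_def)
    have sq1: "int p * int p dvd int (level Q1) * int (level Q1)"
      and sq2: "int p * int p dvd int (level Q2) * int (level Q2)"
      using pl by (auto intro!: mult_dvd_mono)
    have "clears (a * b) Q"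
      unfolding clears_def
    proof (intro allI impI)
      fix i j assume "i < dim_row Q" "j < dim_col Q"
      then have ij: "i < n" "j < n" using Qc by auto
      have "int p * int p dvd (M1 *\<^sub>v unit_vec n i) \<bullet> (M2 *\<^sub>v unit_vec n j)"
      proof (rule isotropic_line_unique[OF p_prime _ x0c _ _ _ r])
        show "odd (int p)" using odd by simp
        show "M1 *\<^sub>v unit_vec n i \<in> carrier_vec n" "y0 \<in> carrier_vec n"
          "M2 *\<^sub>v unit_vec n j \<in> carrier_vec n" by (simp_all add: y0_def)
        show "\<not> vec_dvd (int p) y0" using j0 by (simp add: y0_def)
        show "int p * int p dvd x0 \<bullet> x0" "int p * int p dvd x0 \<bullet> (M1 *\<^sub>v unit_vec n i)"
          unfolding x0_def M1.scalar_prod_M[OF unit_vec_carrier unit_vec_carrier]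
          using sq1 by (rule dvd_mult2)+
        show "int p * int p dvd (M2 *\<^sub>v unit_vec n j) \<bullet> (M2 *\<^sub>v unit_vec n j)"
          "int p * int p dvd y0 \<bullet> (M2 *\<^sub>v unit_vec n j)"
          unfolding y0_def M2.scalar_prod_M[OF unit_vec_carrier unit_vec_carrier]
          using sq2 by (rule dvd_mult2)+
        fix v assume "v \<in> {M1 *\<^sub>v unit_vec n i, y0, M2 *\<^sub>v unit_vec n j}"
        then have "null v" using pl by (auto simp: y0_def intro: P1.null_col P2.null_col)
        then show "vec_dvd (int p) (x0 $ r \<cdot>\<^sub>v v - v $ r \<cdot>\<^sub>v x0)"
          using null_proportional[OF null0 _ r(1)] by blast
      qed
      then obtain t where t: "(M1 *\<^sub>v unit_vec n i) \<bullet> (M2 *\<^sub>v unit_vec n j) = int p * int p * t"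
        by (rule dvdE)
      have "(rat_of_nat p * rat_of_nat p) * (of_nat (a * b) * Q $$ (i,j))
          = (rat_of_nat p * rat_of_nat p) * of_int t"
        using Q_entry[OF ij] unfolding t by (simp add: a b mult_ac)
      then have "of_nat (a * b) * Q $$ (i,j) = of_int t"
        using prime_gt_0_nat[OF p(1)] by (subst (asm) mult_cancel_left) auto
      then show "of_nat (a * b) * Q $$ (i,j) \<in> \<int>" by simp
    qed
    then have "p dvd a * b" using p(2) level_dvd dvd_trans by blast
    moreover have "\<not> p dvd a"
      using simple[OF p(1) odd a[symmetric] M1.level_dvd_det[OF c(1) M1(2) refl]] .
    moreover have "\<not> p dvd b"
      using simple[OF p(1) odd b[symmetric] M2.level_dvd_det[OF c(2) M2(2) refl]] .
    ultimately show False using p(1) by (simp add: prime_dvd_mult_iff)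
  qed
  then have "clears 1 Q" using level_props(2)[of Q] by simp
  then obtain P where P': "P \<in> carrier_mat (dim_row Q) (dim_col Q)" "rat_mat P = of_nat 1 \<cdot>\<^sub>m Q"
    using clears_int_mat by metis
  have "of_nat 1 \<cdot>\<^sub>m Q = Q" by (rule eq_matI) simp_all
  with P' Qc have P: "P \<in> carrier_mat n n" "rat_mat P = Q" by (simp_all only: carrier_matD)
  have e: "map_vec rat_of_int (all_one_vec n) = all_one_vec n" by (auto simp: all_one_vec_def)
  have tP: "rat_mat (transpose_mat P) = transpose_mat Q" by (simp
    add: map_mat_transpose[symmetric] P(2))
  have hom: "rat_mat (A * B) = rat_mat A * rat_mat B"
    if "A \<in> carrier_mat n n" "B \<in> carrier_mat n n" for A B
    using that by (rule of_int_hom.mat_hom_mult)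
  have "transpose_mat Q * Q = transpose_mat Q2 * (Q1 * transpose_mat Q1) * Q2"
    unfolding tQ unfolding Q_def using c
    by (simp add: assoc_mult_mat[of _ n n _ n _ n] mult_carrier_mat[of _ n n])
  also have "\<dots> = 1\<^sub>m n" using c by (simp add: right orth)
  finally have "rat_mat (transpose_mat P * P) = rat_mat (1\<^sub>m n)"
    using P(1) by (simp add: hom tP P(2) of_int_hom.mat_hom_one)
  then have orthP: "transpose_mat P * P = 1\<^sub>m n" by (rule of_int_hom.mat_hom_inj)
  have "transpose_mat Q1 *\<^sub>v (Q1 *\<^sub>v all_one_vec n) = all_one_vec n"
    using assoc_mult_mat_vec[OF c(3,1) all_one_vec_carrier] by (simp add: orth(1))
  then have "Q *\<^sub>v all_one_vec n = all_one_vec n"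
    unfolding Q_def assoc_mult_mat_vec[OF c(3,2) all_one_vec_carrier] one by simp
  then have "map_vec rat_of_int (P *\<^sub>v all_one_vec n) = map_vec rat_of_int (all_one_vec n)"
    unfolding of_int_hom.mult_mat_vec_hom[OF P(1) all_one_vec_carrier] P(2) e .
  then have oneP: "P *\<^sub>v all_one_vec n = all_one_vec n" by (rule of_int_hom.vec_hom_inj)
  have "transpose_mat Q * rat_mat T1 * Q
      = transpose_mat Q2 * ((Q1 * transpose_mat Q1) * rat_mat S * (Q1 * transpose_mat Q1)) * Q2"
    unfolding tQ Q1(2)[symmetric] unfolding Q_def using c R
    by (simp add: assoc_mult_mat[of _ n n _ n _ n] mult_carrier_mat[of _ n n])
  also have "\<dots> = rat_mat T2" using c R Q2(2) by (simp add: right)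
  finally have "rat_mat (transpose_mat P * T1 * P) = rat_mat T2"
    using P(1) by (simp add: hom tP P(2) mult_carrier_mat[of _ n n])
  then have "T2 = transpose_mat P * T1 * P" by (rule of_int_hom.mat_hom_inj[symmetric])
  then show ?thesis unfolding og_iso_iff using P(1) orthP oneP by blast
qed

theorem theorem1p3:
  fixes n :: nat and S :: "int mat" and Q0 :: "rat mat"
  assumes "in_G n S"
    and "regular_rat_orth n Q0"
    and "transpose_mat Q0 * rat_of_int_mat S * Q0 = rat_of_int_mat (- S)"
    and "odd (level Q0)" and "squarefree (level Q0)"
  shows "card (gc_mates n S // {(A, B). og_iso n A B})
           \<le> 2 ^ card (prime_factors (level Q0)) - 1"
proof -
  note S = assms(1)
  have ogS: "oriented_graph n S" using S by (simp add: in_G_def)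
  have sS: "skew_int_mat n S" using ogS by (rule oriented_graph_skew)
  interpret S: skew_int_mat n S by fact
  have nz: "det (walk_mat n S) \<noteq> 0" using S by (auto simp: in_G_def)
  let ?X = "gc_mates n S" and ?r = "{(A, B). og_iso n A B}"
  have skew: "skew_int_mat n T" if "T \<in> ?X" for T
    using that by (intro oriented_graph_skew) (simp add: gc_mates_def)
  have "\<exists>Q. regular_rat_orth n Q \<and> transpose_mat Q * rat_mat S * Q = rat_mat T" if "T \<in> ?X" for T
    using that regular_rat_orth_exists[OF ogS _ _ nz, of T]
    unfolding gc_mates_def rat_of_int_mat_def by blast
  then obtain Q where Q: "regular_rat_orth n (Q T)" "transpose_mat (Q T) * rat_mat S * Q T
    = rat_mat T"
    if "T \<in> ?X" for T by metis
  define g where "g T = prime_factors (level (Q T))" for T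
  have id: "regular_rat_orth n (1\<^sub>m n)" "transpose_mat (1\<^sub>m n) * rat_mat S * 1\<^sub>m n = rat_mat S"
    by (simp_all add: regular_rat_orth_def one_mult_mat_vec[of _ n])
  have "clears 1 (1\<^sub>m n)" by (auto simp: clears_def)
  then have "level (1\<^sub>m n) = 1" using level_dvd by fastforce
  then have id_level: "prime_factors (level (1\<^sub>m n)) = {}" by simp
  have range: "g ` ?X \<subseteq> Pow (prime_factors (level Q0)) - {{}}"
  proof
    fix F assume "F \<in> g ` ?X"
    then obtain T where T: "T \<in> ?X" "F = g T" by auto
    have "g T \<noteq> {}"
    proof
      assume "g T = {}"
      \<comment> \<open>T is compared with S itself, conjugated by the identity, whose level 1 has
        no prime factors. This excludes the empty set and accounts for the -1.\<close>
      then have "og_iso n S T"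
        using same_level_primes_og_iso[OF S sS skew[OF T(1)] id Q[OF T(1)]] id_level
        by (simp add: g_def)
      then show False using T(1) by (simp add: gc_mates_def)
    qed
    moreover have "g T \<subseteq> prime_factors (level Q0)"
      using prime_dvd_level_dvd_converse_level[OF S skew[OF T(1)] Q[OF T(1)] assms(2)
          assms(3)[unfolded rat_of_int_mat_def]] level_props(1)[of Q0]
      by (auto simp: g_def prime_factors_dvd)
    ultimately show "F \<in> Pow (prime_factors (level Q0)) - {{}}" using T(2) by auto
  qed
  have class_eq: "?r `` {A} = ?r `` {B}" if "A \<in> ?X" "B \<in> ?X" "g A = g B" for A B
  proof -
    have AB: "og_iso n A B"
      using same_level_primes_og_iso[OF S skew[OF that(1)] skew[OF that(2)] Q[OF that(1)] Q[OF that(2)]]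
        that(3) by (simp add: g_def)
    have c: "A \<in> carrier_mat n n" "B \<in> carrier_mat n n"
      using that by (auto simp: gc_mates_def oriented_graph_def)
    show ?thesis
      using AB og_iso_sym[OF c(1) AB] og_iso_trans[OF c(1)] og_iso_trans[OF c(2)] by blast
  qed
  have fin: "finite (g ` ?X)" using range by (rule finite_subset) simp
  \<comment> \<open>A class is recovered from the value of \<open>g\<close> on any member, so there
    are at most as many classes as values of \<open>g\<close>.\<close>
  have "?X // ?r = (\<lambda>F. ?r `` {SOME A. A \<in> ?X \<and> g A = F}) ` (g ` ?X)"
  proof -
    have "?r `` {SOME A. A \<in> ?X \<and> g A = g T} = ?r `` {T}" if "T \<in> ?X" for T
    proof -
      have "(SOME A. A \<in> ?X \<and> g A = g T) \<in> ?X \<and> g (SOME A. A \<in> ?X \<and> g A = g T) = g T"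
        by (rule someI[of "\<lambda>A. A \<in> ?X \<and> g A = g T"]) (use that in auto)
      then show ?thesis using class_eq that by blast
    qed
    then show ?thesis unfolding quotient_def by auto
  qed
  then have "card (?X // ?r) \<le> card (g ` ?X)" using card_image_le[OF fin] by simp
  also have "\<dots> \<le> card (Pow (prime_factors (level Q0)) - {{}})"
    by (rule card_mono[OF _ range]) simp
  also have "\<dots> = 2 ^ card (prime_factors (level Q0)) - 1"
    by (simp add: card_Diff_singleton card_Pow)
  finally show ?thesis .
qed

end
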